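(* Let $d\ge1$ and let $k_1,\dots,k_d$ be integers such that $k_i\ge3$ is odd for every $i<d$ and $k_d\ge3$. Let $f$ be the function on $n=\sum_{i=1}^{d-1}k_i+2k_d$ variables defined in the context. Then $\deg_{\pm}(f)=d$ and $$W(f,d)\ \ge\ 2^{(k_d-2)\prod_{i=1}^{d-1}(k_i-1)\ -\ d\log n}.$$
   Context: Here Boolean values are $\pm1$: $\mathrm{sgn}(t)=1$ if $t\ge0$ and $\mathrm{sgn}(t)=-1$ otherwise. A threshold gate for $f\colon\{-1,1\}^n\to\{-1,1\}$ is an integer-coefficient polynomial $p$ with $f(x)=\mathrm{sgn}(p(x))$ for all $x\in\{-1,1\}^n$; its weight is the sum of absolute values of its coefficients; $\deg_{\pm}(f)$ is the minimal degree of a threshold gate, and $W(f,d)$ (for $d\ge\deg_{\pm}(f)$) is the minimal weight of a threshold gate of degree at most $d$. For $z\in\{-1,1\}^k$ define linear forms $L_0(z)=z_1+z_k$ and $L_j(z)=z_j-z_{j+1}$ for $j=1,\dots,k-1$. The input of $f$ is $(x^1,\dots,x^{d-1},x^d,y^d)$ with $x^i\in\{-1,1\}^{k_i}$ for $i<d$ and $x^d,y^d\in\{-1,1\}^{k_d}$. Let $K=\{0,\dots,k_1-1\}\times\dots\times\{0,\dots,k_{d-1}-1\}\times[k_d]$, $[k]=\{1,\dots,k\}$. For $l<d$, on $\{0,\dots,k_l-1\}$ let $<'_1$ be the order $0,1,2,\dots,k_l-1$ and $<'_0$ the order $0,k_l-1,k_l-2,\dots,1$ (smallest first), with ordinal numbers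 $\mathrm{num}'_1(j)=j$, $\mathrm{num}'_0(0)=0$, $\mathrm{num}'_0(j)=k_l-j$ for $j\ge1$. On $[k_d]$ let $<_1$ be $1,\dots,k_d$ and $<_0$ be $k_d,\dots,1$. For $\alpha\in K$ let $i_1(\alpha)=1$ and, for $l<d$, $i_{l+1}(\alpha)=\mathrm{num}'_{i_l(\alpha)}(\alpha_l)\bmod2$. For $\alpha\neq\beta$ with least differing index $l$, $\alpha<\beta$ iff $\alpha_l$ precedes $\beta_l$ in the order with index $i_l(\alpha)$ (primed orders for $l<d$, unprimed for $l=d$). For $i<d$ let $c_i(\alpha)=1$ if $\alpha_i=0$ and $i_i(\alpha)=0$, and $c_i(\alpha)=0$ otherwise. Then $f(x)=\mathrm{sgn}\big((-1)^{c_1(\alpha)+\dots+c_{d-1}(\alpha)}L_{\alpha_1}(x^1)\cdots L_{\alpha_{d-1}}(x^{d-1})(x^d_{\alpha_d}-y^d_{\alpha_d})\big)$ for the largest $\alpha\in K$ for which this product is nonzero; if there is no such $\alpha$, $f=1$. *)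

theory Defs
  imports Complex_Main "HOL-Library.Poly_Mapping" "HOL-Library.FuncSet"
begin

section \<open>Threshold gates\<close>

text \<open>
  The library's \<open>sgn\<close> is \<open>0\<close> at \<open>0\<close>; here the value at \<open>0\<close> is \<open>1\<close>.
\<close>

definition bsgn :: "int \<Rightarrow> int" where
  "bsgn t = (if t \<ge> 0 then 1 else - 1)"

definition cube :: "'v set \<Rightarrow> ('v \<Rightarrow> int) set" where
  "cube V = (V \<rightarrow>\<^sub>E {- 1, 1})"

text \<open>
  A polynomial maps monomials to coefficients, and a monomial maps variables to exponents, both
  with finite support. Exponents are not restricted, so polynomials need not be multilinear.
\<close>

type_synonym 'v mpoly = "('v \<Rightarrow>\<^sub>0 nat) \<Rightarrow>\<^sub>0 int"

definition mpoly_vars :: "'v mpoly \<Rightarrow> 'v set" where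
  "mpoly_vars p = (\<Union>m \<in> Poly_Mapping.keys p. Poly_Mapping.keys m)"

definition mpoly_eval :: "'v mpoly \<Rightarrow> ('v \<Rightarrow> int) \<Rightarrow> int" where
  "mpoly_eval p x =
     (\<Sum>m \<in> Poly_Mapping.keys p.
        Poly_Mapping.lookup p m * (\<Prod>v \<in> Poly_Mapping.keys m. x v ^ Poly_Mapping.lookup m v))"

definition mpoly_degree :: "'v mpoly \<Rightarrow> nat" where
  "mpoly_degree p =
     Max (insert 0 ((\<lambda>m. \<Sum>v \<in> Poly_Mapping.keys m. Poly_Mapping.lookup m v) ` Poly_Mapping.keys p))"

definition mpoly_weight :: "'v mpoly \<Rightarrow> nat" where
  "mpoly_weight p = (\<Sum>m \<in> Poly_Mapping.keys p. nat \<bar>Poly_Mapping.lookup p m\<bar>)"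

definition threshold_gate :: "'v set \<Rightarrow> (('v \<Rightarrow> int) \<Rightarrow> int) \<Rightarrow> 'v mpoly \<Rightarrow> bool" where
  "threshold_gate V f p \<longleftrightarrow>
     mpoly_vars p \<subseteq> V \<and> (\<forall>x \<in> cube V. f x = bsgn (mpoly_eval p x))"

definition threshold_degree :: "'v set \<Rightarrow> (('v \<Rightarrow> int) \<Rightarrow> int) \<Rightarrow> nat" where
  "threshold_degree V f = (LEAST D. \<exists>p. threshold_gate V f p \<and> mpoly_degree p = D)"

text \<open>
  Meaningful only for \<open>D \<ge> threshold_degree V f\<close>; otherwise there is no gate to minimise over.
\<close>

definition threshold_weight :: "'v set \<Rightarrow> (('v \<Rightarrow> int) \<Rightarrow> int) \<Rightarrow> nat \<Rightarrow> nat" where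
  "threshold_weight V f D =
     (LEAST w. \<exists>p. threshold_gate V f p \<and> mpoly_degree p \<le> D \<and> mpoly_weight p = w)"

section \<open>The function\<close>

text \<open>
  \<open>X i j\<close> is the coordinate $x^i_j$ and \<open>Y j\<close> is $y^d_j$.
\<close>

datatype var = X nat nat | Y nat

definition input_vars :: "nat \<Rightarrow> (nat \<Rightarrow> nat) \<Rightarrow> var set" where
  "input_vars d k = {X i j | i j. i \<in> {1..d} \<and> j \<in> {1..k i}} \<union> {Y j | j. j \<in> {1..k d}}"

definition linform :: "nat \<Rightarrow> nat \<Rightarrow> (nat \<Rightarrow> int) \<Rightarrow> int" where
  "linform k j z = (if j = 0 then z 1 + z k else z j - z (j + 1))"

definition indices :: "nat \<Rightarrow> (nat \<Rightarrow> nat) \<Rightarrow> (nat \<Rightarrow> nat) set" where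
  "indices d k = (\<Pi>\<^sub>E i \<in> {1..d}. if i < d then {0..<k i} else {1..k d})"

definition num' :: "nat \<Rightarrow> nat \<Rightarrow> nat \<Rightarrow> nat" where
  "num' k i j = (if i = 1 then j else if j = 0 then 0 else k - j)"

text \<open>
  \<open>ord_idx k \<alpha> l\<close> is $i_l(\alpha)$ for $l \geq 1$; its value at \<open>l = 0\<close> is irrelevant.
\<close>

fun ord_idx :: "(nat \<Rightarrow> nat) \<Rightarrow> (nat \<Rightarrow> nat) \<Rightarrow> nat \<Rightarrow> nat" where
  "ord_idx k \<alpha> 0 = 1"
| "ord_idx k \<alpha> (Suc 0) = 1"
| "ord_idx k \<alpha> (Suc (Suc l)) = num' (k (Suc l)) (ord_idx k \<alpha> (Suc l)) (\<alpha> (Suc l)) mod 2"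

definition prec' :: "nat \<Rightarrow> nat \<Rightarrow> nat \<Rightarrow> nat \<Rightarrow> bool" where
  "prec' k i a b \<longleftrightarrow> num' k i a < num' k i b"

definition prec :: "nat \<Rightarrow> nat \<Rightarrow> nat \<Rightarrow> bool" where
  "prec i a b \<longleftrightarrow> (if i = 1 then a < b else b < a)"

definition index_less :: "nat \<Rightarrow> (nat \<Rightarrow> nat) \<Rightarrow> (nat \<Rightarrow> nat) \<Rightarrow> (nat \<Rightarrow> nat) \<Rightarrow> bool" where
  "index_less d k \<alpha> \<beta> \<longleftrightarrow>
     (\<exists>l \<in> {1..d}. (\<forall>m \<in> {1..<l}. \<alpha> m = \<beta> m) \<and> \<alpha> l \<noteq> \<beta> l \<and>
        (if l < d then prec' (k l) (ord_idx k \<alpha> l) (\<alpha> l) (\<beta> l)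
         else prec (ord_idx k \<alpha> l) (\<alpha> l) (\<beta> l)))"

definition sign_exp :: "(nat \<Rightarrow> nat) \<Rightarrow> (nat \<Rightarrow> nat) \<Rightarrow> nat \<Rightarrow> nat" where
  "sign_exp k \<alpha> i = (if \<alpha> i = 0 \<and> ord_idx k \<alpha> i = 0 then 1 else 0)"

definition signed_product :: "nat \<Rightarrow> (nat \<Rightarrow> nat) \<Rightarrow> (var \<Rightarrow> int) \<Rightarrow> (nat \<Rightarrow> nat) \<Rightarrow> int" where
  "signed_product d k x \<alpha> =
     (- 1) ^ (\<Sum>i = 1..<d. sign_exp k \<alpha> i) *
     (\<Prod>i = 1..<d. linform (k i) (\<alpha> i) (\<lambda>j. x (X i j))) *
     (x (X d (\<alpha> d)) - x (Y (\<alpha> d)))"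

definition is_leading :: "nat \<Rightarrow> (nat \<Rightarrow> nat) \<Rightarrow> (var \<Rightarrow> int) \<Rightarrow> (nat \<Rightarrow> nat) \<Rightarrow> bool" where
  "is_leading d k x \<alpha> \<longleftrightarrow>
     \<alpha> \<in> indices d k \<and> signed_product d k x \<alpha> \<noteq> 0 \<and>
     (\<forall>\<beta> \<in> indices d k. signed_product d k x \<beta> \<noteq> 0 \<and> \<beta> \<noteq> \<alpha> \<longrightarrow> index_less d k \<beta> \<alpha>)"

definition hard_fun :: "nat \<Rightarrow> (nat \<Rightarrow> nat) \<Rightarrow> (var \<Rightarrow> int) \<Rightarrow> int" where
  "hard_fun d k x =
     (if \<exists>\<alpha> \<in> indices d k. signed_product d k x \<alpha> \<noteq> 0
      then bsgn (signed_product d k x (THE \<alpha>. is_leading d k x \<alpha>))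
      else 1)"

lemma card_input_vars:
  assumes "d \<ge> 1"
  shows "card (input_vars d k) = (\<Sum>i = 1..<d. k i) + 2 * k d"
proof -
  have X: "{X i j | i j. i \<in> {1..d} \<and> j \<in> {1..k i}} =
      (\<lambda>(i, j). X i j) ` (SIGMA i:{1..d}. {1..k i})"
    by auto
  have Y: "{Y j | j. j \<in> {1..k d}} = Y ` {1..k d}"
    by auto
  have cX: "card ((\<lambda>(i, j). X i j) ` (SIGMA i:{1..d}. {1..k i})) = (\<Sum>i = 1..d. k i)"
    by (subst card_image) (auto simp: inj_on_def)
  have cY: "card (Y ` {1..k d}) = k d"
    by (subst card_image) (auto simp: inj_on_def)
  have "{1..d} = insert d {1..<d}"
    using assms by auto
  then have s: "(\<Sum>i = 1..d. k i) = k d + (\<Sum>i = 1..<d. k i)"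
    by simp
  have "card (input_vars d k) = (\<Sum>i = 1..d. k i) + k d"
    unfolding input_vars_def X Y
    by (subst card_Un_disjoint) (use cX cY in auto)
  then show ?thesis
    using s by simp
qed

lemma ord_idx_cong: "(\<And>m. m \<in> {1..<l} \<Longrightarrow> \<alpha> m = \<beta> m) \<Longrightarrow> ord_idx k \<alpha> l = ord_idx k \<beta> l"
  by (induction k \<alpha> l rule: ord_idx.induct) auto

lemma index_less_total:
  assumes "\<alpha> \<in> indices d k" "\<beta> \<in> indices d k" "\<alpha> \<noteq> \<beta>"
  shows "index_less d k \<alpha> \<beta> \<or> index_less d k \<beta> \<alpha>"
proof -
  have "\<exists>l. l \<in> {1..d} \<and> \<alpha> l \<noteq> \<beta> l"
  proof (rule ccontr)
    assume "\<not> ?thesis"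
    then have "\<alpha> m = \<beta> m" if "m \<in> {1..d}" for m
      using that by blast
    then have "\<alpha> = \<beta>"
      by (rule PiE_ext[OF assms(1,2)[unfolded indices_def]])
    then show False
      using assms(3) by simp
  qed
  then obtain l where "l \<in> {1..d} \<and> \<alpha> l \<noteq> \<beta> l" and
    least: "\<forall>m < l. \<not> (m \<in> {1..d} \<and> \<alpha> m \<noteq> \<beta> m)"
    using exists_least_iff[of "\<lambda>l. l \<in> {1..d} \<and> \<alpha> l \<noteq> \<beta> l"] by blast
  then have l: "l \<in> {1..d}" "\<alpha> l \<noteq> \<beta> l"
    by simp_all
  have eq: "\<forall>m \<in> {1..<l}. \<alpha> m = \<beta> m"
    using least l(1) by simp
  have oi: "ord_idx k \<beta> l = ord_idx k \<alpha> l"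
    by (rule ord_idx_cong) (simp add: eq)
  have lt: "\<alpha> l < k l" "\<beta> l < k l" if "l < d"
    using PiE_mem[OF assms(1)[unfolded indices_def] l(1)]
      PiE_mem[OF assms(2)[unfolded indices_def] l(1)] that by simp_all
  have "prec' (k l) (ord_idx k \<alpha> l) (\<alpha> l) (\<beta> l) \<or> prec' (k l) (ord_idx k \<alpha> l) (\<beta> l) (\<alpha> l)"
    if "l < d"
    using lt[OF that] l(2) unfolding prec'_def num'_def by auto
  moreover have "prec (ord_idx k \<alpha> l) (\<alpha> l) (\<beta> l) \<or> prec (ord_idx k \<alpha> l) (\<beta> l) (\<alpha> l)"
    using l(2) unfolding prec_def by auto
  ultimately consider
      "if l < d then prec' (k l) (ord_idx k \<alpha> l) (\<alpha> l) (\<beta> l)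
       else prec (ord_idx k \<alpha> l) (\<alpha> l) (\<beta> l)"
    | "if l < d then prec' (k l) (ord_idx k \<beta> l) (\<beta> l) (\<alpha> l)
       else prec (ord_idx k \<beta> l) (\<beta> l) (\<alpha> l)"
    unfolding oi by (cases "l < d") auto
  then show ?thesis
  proof cases
    case 1
    then have "index_less d k \<alpha> \<beta>"
      unfolding index_less_def using l eq by (intro bexI[of _ l]) simp_all
    then show ?thesis ..
  next
    case 2
    then have "index_less d k \<beta> \<alpha>"
      unfolding index_less_def using l eq by (intro bexI[of _ l]) simp_all
    then show ?thesis ..
  qed
qed

lemma index_lessE:
  assumes "index_less d k \<alpha> \<beta>"
  obtains l where "l \<in> {1..d}" "\<forall>m \<in> {1..<l}. \<alpha> m = \<beta> m" "\<alpha> l \<noteq> \<beta> l"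
    "if l < d then prec' (k l) (ord_idx k \<alpha> l) (\<alpha> l) (\<beta> l)
     else prec (ord_idx k \<alpha> l) (\<alpha> l) (\<beta> l)"
  using assms unfolding index_less_def by (elim bexE conjE) (rule that)

lemma index_less_asym: "index_less d k \<alpha> \<beta> \<Longrightarrow> \<not> index_less d k \<beta> \<alpha>"
proof
  assume lt: "index_less d k \<alpha> \<beta>" and gt: "index_less d k \<beta> \<alpha>"
  from lt obtain l where l:
    "l \<in> {1..d}" "\<forall>m \<in> {1..<l}. \<alpha> m = \<beta> m" "\<alpha> l \<noteq> \<beta> l"
    "if l < d then prec' (k l) (ord_idx k \<alpha> l) (\<alpha> l) (\<beta> l)
     else prec (ord_idx k \<alpha> l) (\<alpha> l) (\<beta> l)"
    by (rule index_lessE)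
  from gt obtain l' where l':
    "l' \<in> {1..d}" "\<forall>m \<in> {1..<l'}. \<beta> m = \<alpha> m" "\<beta> l' \<noteq> \<alpha> l'"
    "if l' < d then prec' (k l') (ord_idx k \<beta> l') (\<beta> l') (\<alpha> l')
     else prec (ord_idx k \<beta> l') (\<beta> l') (\<alpha> l')"
    by (rule index_lessE)
  have "l = l'"
  proof (rule linorder_cases[of l l'])
    assume "l < l'"
    then show ?thesis using l(1,3) l'(2) by simp
  next
    assume "l' < l"
    then show ?thesis using l'(1,3) l(2) by simp
  qed
  moreover have "ord_idx k \<beta> l = ord_idx k \<alpha> l"
    by (rule ord_idx_cong) (simp add: l(2))
  ultimately show False
    using l(4) l'(4) by (simp add: prec'_def prec_def split: if_splits)
qed

lemma index_less_trans:
  assumes "index_less d k \<alpha> \<beta>" "index_less d k \<beta> \<gamma>"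
  shows "index_less d k \<alpha> \<gamma>"
proof -
  from assms(1) obtain l where l:
    "l \<in> {1..d}" "\<forall>m \<in> {1..<l}. \<alpha> m = \<beta> m" "\<alpha> l \<noteq> \<beta> l"
    "if l < d then prec' (k l) (ord_idx k \<alpha> l) (\<alpha> l) (\<beta> l)
     else prec (ord_idx k \<alpha> l) (\<alpha> l) (\<beta> l)"
    by (rule index_lessE)
  from assms(2) obtain l' where l':
    "l' \<in> {1..d}" "\<forall>m \<in> {1..<l'}. \<beta> m = \<gamma> m" "\<beta> l' \<noteq> \<gamma> l'"
    "if l' < d then prec' (k l') (ord_idx k \<beta> l') (\<beta> l') (\<gamma> l')
     else prec (ord_idx k \<beta> l') (\<beta> l') (\<gamma> l')"
    by (rule index_lessE)
  have oi: "ord_idx k \<beta> m = ord_idx k \<alpha> m" if "m \<le> l" for m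
    by (rule ord_idx_cong) (use l(2) that in simp)
  consider "l < l'" | "l' < l" | "l = l'"
    by linarith
  then show ?thesis
  proof cases
    case 1
    then have "\<beta> l = \<gamma> l" "\<forall>m \<in> {1..<l}. \<alpha> m = \<gamma> m"
      using l(1,2) l'(2) by simp_all
    then show ?thesis
      unfolding index_less_def using l by (intro bexI[of _ l]) (simp_all split: if_splits)
  next
    case 2
    then have "\<alpha> l' = \<beta> l'" "\<forall>m \<in> {1..<l'}. \<alpha> m = \<gamma> m"
      using l(2) l'(1,2) by simp_all
    then show ?thesis
      unfolding index_less_def using 2 l' oi[of l'] by (intro bexI[of _ l']) (simp_all split: if_splits)
  next
    case 3
    then have "\<forall>m \<in> {1..<l}. \<alpha> m = \<gamma> m"
      using l(2) l'(2) by simp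
    moreover have rel: "if l < d then prec' (k l) (ord_idx k \<alpha> l) (\<alpha> l) (\<gamma> l)
        else prec (ord_idx k \<alpha> l) (\<alpha> l) (\<gamma> l)"
    proof (cases "l < d")
      case True
      then show ?thesis
        using l(4) l'(4) oi[of l] 3 by (simp add: prec'_def)
    next
      case False
      then have "prec (ord_idx k \<alpha> l) (\<alpha> l) (\<beta> l)" "prec (ord_idx k \<alpha> l) (\<beta> l) (\<gamma> l)"
        using l(4) l'(4) oi[of l] 3 by simp_all
      then show ?thesis
        using False unfolding prec_def by (cases "ord_idx k \<alpha> l = 1") simp_all
    qed
    moreover have "\<alpha> l \<noteq> \<gamma> l"
    proof
      assume "\<alpha> l = \<gamma> l"
      then show False
        using rel by (cases "l < d") (simp_all add: prec'_def prec_def)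
    qed
    ultimately show ?thesis
      unfolding index_less_def using l(1) by (intro bexI[of _ l]) simp_all
  qed
qed

lemma is_leading_unique:
  assumes "is_leading d k x \<alpha>" "is_leading d k x \<beta>"
  shows "\<alpha> = \<beta>"
proof (rule ccontr)
  assume "\<alpha> \<noteq> \<beta>"
  then have "index_less d k \<alpha> \<beta>" "index_less d k \<beta> \<alpha>"
    using assms unfolding is_leading_def by simp_all
  then show False
    using index_less_asym by simp
qed

lemma is_leading_exists:
  assumes "\<exists>\<alpha> \<in> indices d k. signed_product d k x \<alpha> \<noteq> 0"
  shows "\<exists>\<alpha>. is_leading d k x \<alpha>"
proof -
  define A where "A = {\<alpha> \<in> indices d k. signed_product d k x \<alpha> \<noteq> 0}"
  have "finite (indices d k)"
    unfolding indices_def by (rule finite_PiE) auto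
  then have "finite A"
    unfolding A_def by simp
  have "B \<noteq> {} \<Longrightarrow> \<exists>\<alpha> \<in> B. \<forall>\<beta> \<in> B. \<beta> \<noteq> \<alpha> \<longrightarrow> index_less d k \<beta> \<alpha>"
    if "finite B" "B \<subseteq> indices d k" for B
    using that
  proof (induction B rule: finite_induct)
    case empty
    then show ?case by simp
  next
    case (insert b B)
    show ?case
    proof (cases "B = {}")
      case True
      then show ?thesis by simp
    next
      case False
      then obtain \<alpha> where \<alpha>: "\<alpha> \<in> B" "\<forall>\<beta> \<in> B. \<beta> \<noteq> \<alpha> \<longrightarrow> index_less d k \<beta> \<alpha>"
        using insert by auto
      have "\<alpha> \<noteq> b" "\<alpha> \<in> indices d k" "b \<in> indices d k"
        using \<alpha> insert by auto
      then consider "index_less d k b \<alpha>" | "index_less d k \<alpha> b"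
        using index_less_total by blast
      then show ?thesis
      proof cases
        case 1
        then show ?thesis using \<alpha> by (intro bexI[of _ \<alpha>]) auto
      next
        case 2
        have "index_less d k \<beta> b" if "\<beta> \<in> B" for \<beta>
          using \<alpha>(2) 2 that index_less_trans[OF _ 2, of \<beta>] by (cases "\<beta> = \<alpha>") auto
        then show ?thesis by auto
      qed
    qed
  qed
  moreover have "A \<subseteq> indices d k" "A \<noteq> {}"
    using assms unfolding A_def by auto
  ultimately obtain \<alpha> where "\<alpha> \<in> A" "\<forall>\<beta> \<in> A. \<beta> \<noteq> \<alpha> \<longrightarrow> index_less d k \<beta> \<alpha>"
    using \<open>finite A\<close> by meson
  then have "is_leading d k x \<alpha>"
    unfolding A_def is_leading_def by simp
  then show ?thesis
    by (rule exI[of _ \<alpha>])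
qed

end

theory Submission
  imports Defs
begin

text \<open>
  The function changes sign when a block \<open>x\<^sup>i\<close> with \<open>i < d\<close> is negated and when \<open>x\<^sup>d\<close> and \<open>y\<^sup>d\<close>
  are exchanged, unless all products vanish. Antisymmetrising a gate over these \<open>2\<^sup>d\<close> symmetries
  keeps its sign, increases its values by a factor of at most \<open>2\<^sup>d\<close>, and kills every monomial that
  misses a block. Hence no gate has degree below \<open>d\<close>, and in degree \<open>d\<close> what survives is a form
  \<open>T\<close> that is linear in each of \<open>x\<^sup>1, \<dots>, x\<^sup>d\<^sup>-\<^sup>1, x\<^sup>d - y\<^sup>d\<close>.

  For an index \<open>\<alpha>\<close> let \<open>V \<alpha>\<close> be the value of \<open>T\<close> at a point where only the product of \<open>\<alpha>\<close> is
  nonzero. Points with several nonzero products give inequalities between these integers. On the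
  indices without zero coordinates, \<open>V\<close> increases when one coordinate \<open>l < d\<close> moves forward in its
  order; the coordinate \<open>0\<close> only serves to make the number of nonzero forms odd, which is forced.
  In the last coordinate each \<open>V \<alpha>\<close> exceeds the sum of its predecessors. As the \<open>k\<^sub>l\<close> are odd, the
  two orders on every level are reverses of each other on these indices, so they are traversed
  like a snake: the \<open>\<Prod>(k\<^sub>i - 1)\<close> runs through the last coordinate are joined by steps that change a
  single earlier coordinate, and each run gains a factor \<open>2 ^ (k\<^sub>d - 2)\<close>.
\<close>

section \<open>Polynomials\<close>

lemma abs_prod_int: "\<bar>\<Prod>a \<in> A. (f a :: int)\<bar> = (\<Prod>a \<in> A. \<bar>f a\<bar>)"
  by (induction A rule: infinite_finite_induct) (simp_all add: abs_mult)

definition monom_eval :: "('v \<Rightarrow>\<^sub>0 nat) \<Rightarrow> ('v \<Rightarrow> int) \<Rightarrow> int" where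
  "monom_eval m x = (\<Prod>v \<in> Poly_Mapping.keys m. x v ^ Poly_Mapping.lookup m v)"

definition monom_degree :: "('v \<Rightarrow>\<^sub>0 nat) \<Rightarrow> nat" where
  "monom_degree m = (\<Sum>v \<in> Poly_Mapping.keys m. Poly_Mapping.lookup m v)"

lemma mpoly_eval_monom_eval:
  "mpoly_eval p x = (\<Sum>m \<in> Poly_Mapping.keys p. Poly_Mapping.lookup p m * monom_eval m x)"
  by (simp add: mpoly_eval_def monom_eval_def)

lemma mpoly_degree_le_iff:
  "mpoly_degree p \<le> D \<longleftrightarrow> (\<forall>m \<in> Poly_Mapping.keys p. monom_degree m \<le> D)"
  by (simp add: mpoly_degree_def monom_degree_def)

lemma monom_eval_superset:
  assumes "finite A" "Poly_Mapping.keys m \<subseteq> A"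
  shows "monom_eval m x = (\<Prod>v \<in> A. x v ^ Poly_Mapping.lookup m v)"
  unfolding monom_eval_def
  by (rule prod.mono_neutral_left) (use assms in \<open>auto simp: in_keys_iff\<close>)

lemma monom_degree_superset:
  assumes "finite A" "Poly_Mapping.keys m \<subseteq> A"
  shows "monom_degree m = (\<Sum>v \<in> A. Poly_Mapping.lookup m v)"
  unfolding monom_degree_def
  by (rule sum.mono_neutral_left) (use assms in \<open>auto simp: in_keys_iff\<close>)

lemma mpoly_eval_superset:
  assumes "finite A" "Poly_Mapping.keys p \<subseteq> A"
  shows "mpoly_eval p x = (\<Sum>m \<in> A. Poly_Mapping.lookup p m * monom_eval m x)"
  unfolding mpoly_eval_monom_eval
  by (rule sum.mono_neutral_left) (use assms in \<open>auto simp: in_keys_iff\<close>)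

lemma monom_eval_add: "monom_eval (m + m') x = monom_eval m x * monom_eval m' x"
proof -
  let ?A = "Poly_Mapping.keys m \<union> Poly_Mapping.keys m'"
  have "monom_eval (m + m') x = (\<Prod>v \<in> ?A. x v ^ Poly_Mapping.lookup (m + m') v)"
    by (rule monom_eval_superset) (simp_all add: Poly_Mapping.keys_add)
  moreover have "monom_eval m x = (\<Prod>v \<in> ?A. x v ^ Poly_Mapping.lookup m v)"
    by (rule monom_eval_superset) simp_all
  moreover have "monom_eval m' x = (\<Prod>v \<in> ?A. x v ^ Poly_Mapping.lookup m' v)"
    by (rule monom_eval_superset) simp_all
  ultimately show ?thesis
    by (simp add: lookup_add power_add prod.distrib)
qed

lemma monom_degree_add: "monom_degree (m + m') = monom_degree m + monom_degree m'"
proof -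
  let ?A = "Poly_Mapping.keys m \<union> Poly_Mapping.keys m'"
  have "monom_degree (m + m') = (\<Sum>v \<in> ?A. Poly_Mapping.lookup (m + m') v)"
    by (rule monom_degree_superset) (simp_all add: Poly_Mapping.keys_add)
  moreover have "monom_degree m = (\<Sum>v \<in> ?A. Poly_Mapping.lookup m v)"
    by (rule monom_degree_superset) simp_all
  moreover have "monom_degree m' = (\<Sum>v \<in> ?A. Poly_Mapping.lookup m' v)"
    by (rule monom_degree_superset) simp_all
  ultimately show ?thesis
    by (simp add: lookup_add sum.distrib)
qed

lemma mpoly_eval_add: "mpoly_eval (p + q) x = mpoly_eval p x + mpoly_eval q x"
proof -
  let ?A = "Poly_Mapping.keys p \<union> Poly_Mapping.keys q"
  have "mpoly_eval (p + q) x = (\<Sum>m \<in> ?A. Poly_Mapping.lookup (p + q) m * monom_eval m x)"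
    by (rule mpoly_eval_superset) (simp_all add: Poly_Mapping.keys_add)
  moreover have "mpoly_eval p x = (\<Sum>m \<in> ?A. Poly_Mapping.lookup p m * monom_eval m x)"
    by (rule mpoly_eval_superset) simp_all
  moreover have "mpoly_eval q x = (\<Sum>m \<in> ?A. Poly_Mapping.lookup q m * monom_eval m x)"
    by (rule mpoly_eval_superset) simp_all
  ultimately show ?thesis
    by (simp add: lookup_add algebra_simps sum.distrib)
qed

text \<open>Phrased through the induced function, so that a gate can be assembled by closure rules
  without forming products of polynomials.\<close>

definition poly_fun :: "'v set \<Rightarrow> nat \<Rightarrow> (('v \<Rightarrow> int) \<Rightarrow> int) \<Rightarrow> bool" where
  "poly_fun V D g \<longleftrightarrow>
     (\<exists>p. mpoly_vars p \<subseteq> V \<and> mpoly_degree p \<le> D \<and> (\<forall>x. mpoly_eval p x = g x))"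

lemma poly_fun_monom:
  assumes "Poly_Mapping.keys m \<subseteq> V" "monom_degree m \<le> D"
  shows "poly_fun V D (\<lambda>x. c * monom_eval m x)"
  unfolding poly_fun_def
proof (intro exI conjI allI)
  let ?p = "Poly_Mapping.single m c"
  show "mpoly_vars ?p \<subseteq> V"
    using assms(1) by (simp add: mpoly_vars_def)
  show "mpoly_degree ?p \<le> D"
    using assms(2) by (simp add: mpoly_degree_le_iff)
  show "mpoly_eval ?p x = c * monom_eval m x" for x
    using mpoly_eval_superset[of "{m}" ?p x] by simp
qed

lemma poly_fun_add:
  assumes "poly_fun V D g" "poly_fun V D h"
  shows "poly_fun V D (\<lambda>x. g x + h x)"
proof -
  obtain p q where p: "mpoly_vars p \<subseteq> V" "mpoly_degree p \<le> D" "\<And>x. mpoly_eval p x = g x"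
    and q: "mpoly_vars q \<subseteq> V" "mpoly_degree q \<le> D" "\<And>x. mpoly_eval q x = h x"
    using assms unfolding poly_fun_def by blast
  have keys: "Poly_Mapping.keys (p + q) \<subseteq> Poly_Mapping.keys p \<union> Poly_Mapping.keys q"
    by (rule Poly_Mapping.keys_add)
  show ?thesis
    unfolding poly_fun_def
  proof (intro exI conjI allI)
    show "mpoly_vars (p + q) \<subseteq> V"
      using keys p(1) q(1) unfolding mpoly_vars_def by blast
    show "mpoly_degree (p + q) \<le> D"
      using keys p(2) q(2) unfolding mpoly_degree_le_iff by blast
    show "mpoly_eval (p + q) x = g x + h x" for x
      by (simp add: mpoly_eval_add p(3) q(3))
  qed
qed

lemma poly_fun_0: "poly_fun V D (\<lambda>x. 0)"
  using poly_fun_monom[of 0 V D 0] by (simp add: monom_degree_def)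

lemma poly_fun_sum:
  assumes "\<And>a. a \<in> A \<Longrightarrow> poly_fun V D (g a)"
  shows "poly_fun V D (\<lambda>x. \<Sum>a \<in> A. g a x)"
  using assms
  by (induction A rule: infinite_finite_induct) (simp_all add: poly_fun_0 poly_fun_add)

text \<open>Distributing the monomial over the keys of \<open>p\<close> leaves a sum of single
  monomials, which the earlier closure rules cover.\<close>

lemma poly_fun_monom_mult:
  assumes "Poly_Mapping.keys m \<subseteq> V" "poly_fun V D g"
  shows "poly_fun V (monom_degree m + D) (\<lambda>x. c * monom_eval m x * g x)"
proof -
  obtain p where p: "mpoly_vars p \<subseteq> V" "mpoly_degree p \<le> D" "\<And>x. mpoly_eval p x = g x"
    using assms(2) unfolding poly_fun_def by blast
  have "poly_fun V (monom_degree m + D)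
    (\<lambda>x. \<Sum>m' \<in> Poly_Mapping.keys p. c * Poly_Mapping.lookup p m' * monom_eval (m + m') x)"
  proof (intro poly_fun_sum poly_fun_monom)
    fix m' assume "m' \<in> Poly_Mapping.keys p"
    then have "Poly_Mapping.keys m' \<subseteq> V" "monom_degree m' \<le> D"
      using p(1,2) unfolding mpoly_vars_def mpoly_degree_le_iff by blast+
    then show "Poly_Mapping.keys (m + m') \<subseteq> V" "monom_degree (m + m') \<le> monom_degree m + D"
      using assms(1) Poly_Mapping.keys_add[of m m'] by (auto simp: monom_degree_add)
  qed
  moreover have "(\<lambda>x. \<Sum>m' \<in> Poly_Mapping.keys p.
      c * Poly_Mapping.lookup p m' * monom_eval (m + m') x) = (\<lambda>x. c * monom_eval m x * g x)"
    by (simp add: p(3)[symmetric] mpoly_eval_monom_eval monom_eval_add sum_distrib_left ac_simps)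
  ultimately show ?thesis
    by simp
qed

lemma poly_fun_const_mult: "poly_fun V D g \<Longrightarrow> poly_fun V D (\<lambda>x. c * g x)"
  using poly_fun_monom_mult[of 0 V D g c] by (simp add: monom_degree_def monom_eval_def)

lemma poly_fun_var_mult:
  assumes "v \<in> V" "poly_fun V D g"
  shows "poly_fun V (Suc D) (\<lambda>x. c * x v * g x)"
  using poly_fun_monom_mult[of "Poly_Mapping.single v 1" V D g c] assms
  by (simp add: monom_degree_def monom_eval_def)

lemma poly_fun_binomial_mult:
  assumes "v \<in> V" "w \<in> V" "poly_fun V D g"
  shows "poly_fun V (Suc D) (\<lambda>x. (x v + c * x w) * g x)"
  using poly_fun_add[OF poly_fun_var_mult[OF assms(1,3), of 1] poly_fun_var_mult[OF assms(2,3), of c]]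
  by (simp add: algebra_simps)

lemma abs_mpoly_eval_le_weight:
  assumes "\<And>v. x v \<in> {- 1, 1}"
  shows "\<bar>mpoly_eval p x\<bar> \<le> int (mpoly_weight p)"
proof -
  have "\<bar>monom_eval m x\<bar> = 1" for m
  proof -
    have "\<bar>x v\<bar> = 1" for v
      using assms[of v] by auto
    then show ?thesis
      by (simp add: monom_eval_def abs_prod_int power_abs)
  qed
  then have "\<bar>mpoly_eval p x\<bar> \<le> (\<Sum>m \<in> Poly_Mapping.keys p. \<bar>Poly_Mapping.lookup p m\<bar>)"
    unfolding mpoly_eval_monom_eval
    by (intro order_trans[OF sum_abs]) (simp add: abs_mult)
  then show ?thesis
    by (simp add: mpoly_weight_def)
qed

section \<open>The function\<close>

lemma indices_D:
  assumes "\<alpha> \<in> indices d k"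
  shows "1 \<le> i \<Longrightarrow> i < d \<Longrightarrow> \<alpha> i < k i" and "1 \<le> d \<Longrightarrow> 1 \<le> \<alpha> d \<and> \<alpha> d \<le> k d"
proof -
  show "\<alpha> i < k i" if "1 \<le> i" "i < d"
    using PiE_mem[OF assms[unfolded indices_def], of i] that by simp
  show "1 \<le> \<alpha> d \<and> \<alpha> d \<le> k d" if "1 \<le> d"
    using PiE_mem[OF assms[unfolded indices_def], of d] that by simp
qed

lemma finite_indices: "finite (indices d k)"
  unfolding indices_def by (rule finite_PiE) auto

lemma indices_upd:
  assumes "\<alpha> \<in> indices d k" "1 \<le> l" "l \<le> d" "if l < d then a < k l else 1 \<le> a \<and> a \<le> k d"
  shows "\<alpha>(l := a) \<in> indices d k"
  using assms unfolding indices_def PiE_iff extensional_def by (auto split: if_splits)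

lemma hard_fun_leading:
  assumes "is_leading d k x \<alpha>"
  shows "hard_fun d k x = bsgn (signed_product d k x \<alpha>)"
proof -
  have "(THE \<alpha>. is_leading d k x \<alpha>) = \<alpha>"
    using assms is_leading_unique by blast
  moreover have "\<exists>\<alpha> \<in> indices d k. signed_product d k x \<alpha> \<noteq> 0"
    using assms unfolding is_leading_def by blast
  ultimately show ?thesis
    by (simp add: hard_fun_def)
qed

lemma hard_fun_no_leading:
  "\<not> (\<exists>\<alpha> \<in> indices d k. signed_product d k x \<alpha> \<noteq> 0) \<Longrightarrow> hard_fun d k x = 1"
  by (simp add: hard_fun_def)

text \<open>A common nonzero factor preserves which products vanish, hence also the leading index.
  The factors that matter are the signs caused by negating blocks and by the swap.\<close>

lemma hard_fun_scaled:
  assumes "is_leading d k x \<alpha>" "c \<noteq> 0"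
    and "\<And>\<beta>. \<beta> \<in> indices d k \<Longrightarrow> signed_product d k y \<beta> = c * signed_product d k x \<beta>"
  shows "hard_fun d k y = bsgn (c * signed_product d k x \<alpha>)"
proof -
  have "is_leading d k y \<alpha>"
    using assms unfolding is_leading_def by simp
  moreover have "\<alpha> \<in> indices d k"
    using assms(1) by (simp add: is_leading_def)
  ultimately show ?thesis
    by (simp add: hard_fun_leading assms(3))
qed

lemma hard_fun_cong:
  assumes "\<And>\<beta>. \<beta> \<in> indices d k \<Longrightarrow> signed_product d k y \<beta> = signed_product d k x \<beta>"
  shows "hard_fun d k y = hard_fun d k x"
proof (cases "\<exists>\<alpha> \<in> indices d k. signed_product d k x \<alpha> \<noteq> 0")
  case True
  then obtain \<alpha> where "is_leading d k x \<alpha>"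
    using is_leading_exists by blast
  then show ?thesis
    using hard_fun_scaled[of d k x \<alpha> 1 y] assms by (simp add: hard_fun_leading)
next
  case False
  then show ?thesis
    using assms by (simp add: hard_fun_no_leading)
qed

lemma input_vars_X: "1 \<le> i \<Longrightarrow> i \<le> d \<Longrightarrow> 1 \<le> j \<Longrightarrow> j \<le> k i \<Longrightarrow> X i j \<in> input_vars d k"
  and input_vars_Y: "1 \<le> j \<Longrightarrow> j \<le> k d \<Longrightarrow> Y j \<in> input_vars d k"
  by (simp_all add: input_vars_def)

lemma linform_cong:
  assumes "c < K" "\<And>j. 1 \<le> j \<Longrightarrow> j \<le> K \<Longrightarrow> z j = z' j"
  shows "linform K c z = linform K c z'"
  using assms by (auto simp: linform_def)

lemma signed_product_restrict:
  assumes "d \<ge> 1" "\<alpha> \<in> indices d k"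
  shows "signed_product d k (restrict x (input_vars d k)) \<alpha> = signed_product d k x \<alpha>"
proof -
  have "(\<Prod>i = 1..<d. linform (k i) (\<alpha> i) (\<lambda>j. restrict x (input_vars d k) (X i j))) =
    (\<Prod>i = 1..<d. linform (k i) (\<alpha> i) (\<lambda>j. x (X i j)))"
    using indices_D(1)[OF assms(2)]
    by (intro prod.cong linform_cong) (auto simp: input_vars_X)
  then show ?thesis
    using indices_D(2)[OF assms(2,1)] assms(1)
    by (simp add: signed_product_def input_vars_X input_vars_Y)
qed

text \<open>Members of \<open>cube\<close> are fixed to \<open>undefined\<close> outside the
  variable set. Both sides depend on the variables in the set only, so total sign assignments, which
  negation and swap preserve, can be used throughout.\<close>

lemma threshold_gate_total:
  assumes "d \<ge> 1" "threshold_gate (input_vars d k) (hard_fun d k) p" "\<And>v. x v \<in> {- 1, 1}"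
  shows "bsgn (mpoly_eval p x) = hard_fun d k x"
proof -
  let ?V = "input_vars d k"
  have "restrict x ?V \<in> cube ?V"
    using assms(3) by (simp add: cube_def)
  then have "hard_fun d k (restrict x ?V) = bsgn (mpoly_eval p (restrict x ?V))"
    using assms(2) by (simp add: threshold_gate_def)
  moreover have "mpoly_eval p (restrict x ?V) = mpoly_eval p x"
    using assms(2) unfolding mpoly_eval_def threshold_gate_def mpoly_vars_def
    by (intro sum.cong prod.cong arg_cong2[of _ _ _ _ "(*)"] arg_cong2[of _ _ _ _ "(^)"] refl)
      (auto simp: restrict_def)
  moreover have "hard_fun d k (restrict x ?V) = hard_fun d k x"
    by (rule hard_fun_cong) (rule signed_product_restrict[OF assms(1)])
  ultimately show ?thesis
    by simp
qed

section \<open>A gate of degree \<open>d\<close>\<close>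

lemma poly_fun_signed_product:
  assumes "d \<ge> 1" "\<alpha> \<in> indices d k"
  shows "poly_fun (input_vars d k) d (\<lambda>x. signed_product d k x \<alpha>)"
proof -
  let ?V = "input_vars d k"
  have "poly_fun ?V e (\<lambda>x. \<Prod>i = 1..<Suc e. linform (k i) (\<alpha> i) (\<lambda>j. x (X i j)))" if "e < d" for e
    using that
  proof (induction e)
    case 0
    show ?case
      using poly_fun_monom[of 0 ?V 0 1] by (simp add: monom_degree_def monom_eval_def)
  next
    case (Suc e)
    let ?i = "Suc e"
    let ?g = "\<lambda>x. \<Prod>i = 1..<?i. linform (k i) (\<alpha> i) (\<lambda>j. x (X i j))"
    have g: "poly_fun ?V e ?g"
      using Suc by simp
    have lt: "\<alpha> ?i < k ?i"
      using indices_D(1)[OF assms(2), of ?i] Suc.prems by simp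
    have "poly_fun ?V ?i (\<lambda>x. linform (k ?i) (\<alpha> ?i) (\<lambda>j. x (X ?i j)) * ?g x)"
    proof (cases "\<alpha> ?i = 0")
      case True
      then show ?thesis
        using poly_fun_binomial_mult[OF _ _ g, of "X ?i 1" "X ?i (k ?i)" 1] lt Suc.prems
        by (simp add: linform_def input_vars_X)
    next
      case False
      then show ?thesis
        using poly_fun_binomial_mult[OF _ _ g, of "X ?i (\<alpha> ?i)" "X ?i (Suc (\<alpha> ?i))" "- 1"] lt Suc.prems
        by (simp add: linform_def input_vars_X)
    qed
    then show ?case
      by (simp add: mult.commute)
  qed
  from this[of "d - 1"] assms(1)
  have "poly_fun ?V (d - 1) (\<lambda>x. \<Prod>i = 1..<d. linform (k i) (\<alpha> i) (\<lambda>j. x (X i j)))"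
    by simp
  then have "poly_fun ?V (Suc (d - 1)) (\<lambda>x. (x (X d (\<alpha> d)) + - 1 * x (Y (\<alpha> d))) *
      (\<Prod>i = 1..<d. linform (k i) (\<alpha> i) (\<lambda>j. x (X i j))))"
    using indices_D(2)[OF assms(2,1)] assms(1)
    by (intro poly_fun_binomial_mult input_vars_X input_vars_Y) simp_all
  then have "poly_fun ?V d (\<lambda>x. (x (X d (\<alpha> d)) + - 1 * x (Y (\<alpha> d))) *
      (\<Prod>i = 1..<d. linform (k i) (\<alpha> i) (\<lambda>j. x (X i j))))"
    using assms(1) by simp
  from poly_fun_const_mult[OF this, of "(- 1) ^ (\<Sum>i = 1..<d. sign_exp k \<alpha> i)"] show ?thesis
    by (simp add: signed_product_def ac_simps)
qed

lemma abs_signed_product_le: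
  assumes "d \<ge> 1" "\<And>v. x v \<in> {- 1, 1}"
  shows "\<bar>signed_product d k x \<alpha>\<bar> \<le> 2 ^ d"
proof -
  have two: "\<bar>x v + x w\<bar> \<le> 2" "\<bar>x v - x w\<bar> \<le> 2" for v w
    using assms(2)[of v] assms(2)[of w] by auto
  have "(\<Prod>i = 1..<d. \<bar>linform (k i) (\<alpha> i) (\<lambda>j. x (X i j))\<bar>) \<le> (\<Prod>i = 1..<d. 2)"
    by (rule prod_mono) (auto simp: linform_def two)
  then have "(\<Prod>i = 1..<d. \<bar>linform (k i) (\<alpha> i) (\<lambda>j. x (X i j))\<bar>) * \<bar>x (X d (\<alpha> d)) - x (Y (\<alpha> d))\<bar>
      \<le> 2 ^ (d - 1) * 2"
    by (intro mult_mono two prod_nonneg) simp_all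
  also have "2 ^ (d - 1) * 2 = (2 :: int) ^ d"
    using assms(1) by (simp add: power_eq_if)
  finally show ?thesis
    by (simp add: signed_product_def abs_mult abs_prod_int power_abs)
qed

lemma bsgn_dominant:
  assumes "\<bar>b\<bar> < \<bar>a\<bar>"
  shows "bsgn (a + b) = bsgn a"
  using assms by (auto simp: bsgn_def)

lemma bsgn_pos_mult: "0 < c \<Longrightarrow> bsgn (c * a) = bsgn a"
  by (simp add: bsgn_def zero_le_mult_iff)

text \<open>Weighting the products by powers of a large base, as in a positional number system, lets
  the leading product outweigh all the others together.\<close>

lemma threshold_gate_exists:
  assumes "d \<ge> 1"
  shows "\<exists>p. threshold_gate (input_vars d k) (hard_fun d k) p \<and> mpoly_degree p \<le> d"
proof -
  let ?V = "input_vars d k" and ?K = "indices d k"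
  define rk where "rk \<alpha> = card {\<beta> \<in> ?K. index_less d k \<beta> \<alpha>}" for \<alpha>
  \<comment> \<open>Each product is at most \<open>2 ^ d\<close> in absolute value on sign points,
    so \<open>N\<close> exceeds any sum of \<open>card ?K\<close> of them.\<close>
  define N :: int where "N = 2 ^ d * (1 + int (card ?K))"
  have "N > 2 ^ d * int (card ?K)"
    by (simp add: N_def algebra_simps)
  moreover have "0 \<le> 2 ^ d * int (card ?K)"
    by simp
  ultimately have N: "N \<ge> 1" "N > 2 ^ d * int (card ?K)"
    by linarith+
  have rk_less: "rk \<beta> < rk \<alpha>" if "\<beta> \<in> ?K" "index_less d k \<beta> \<alpha>" for \<alpha> \<beta>
    unfolding rk_def
  proof (rule psubset_card_mono)
    show "finite {\<gamma> \<in> ?K. index_less d k \<gamma> \<alpha>}"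
      using finite_indices by simp
    have "\<beta> \<notin> {\<gamma> \<in> ?K. index_less d k \<gamma> \<beta>}"
      using index_less_asym[of d k \<beta> \<beta>] by blast
    then show "{\<gamma> \<in> ?K. index_less d k \<gamma> \<beta>} \<subset> {\<gamma> \<in> ?K. index_less d k \<gamma> \<alpha>}"
      using that index_less_trans[OF _ that(2)] by blast
  qed
  have "poly_fun ?V d (\<lambda>x. \<Sum>\<alpha> \<in> ?K. N ^ rk \<alpha> * signed_product d k x \<alpha>)"
    by (intro poly_fun_sum poly_fun_const_mult poly_fun_signed_product assms)
  then obtain p where p: "mpoly_vars p \<subseteq> ?V" "mpoly_degree p \<le> d"
    "\<And>x. mpoly_eval p x = (\<Sum>\<alpha> \<in> ?K. N ^ rk \<alpha> * signed_product d k x \<alpha>)"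
    unfolding poly_fun_def by blast
  have "hard_fun d k x = bsgn (mpoly_eval p x)" if x: "x \<in> cube ?V" for x
  proof -
    \<comment> \<open>The bound on the products needs signs at all variables, while \<open>x\<close>
      is \<open>undefined\<close> outside \<open>?V\<close>.\<close>
    define y where "y v = (if v \<in> ?V then x v else 1)" for v
    have y: "y v \<in> {- 1, 1}" for v
      using x PiE_mem[of x ?V "\<lambda>_. {- 1, 1}" v] by (simp add: cube_def y_def)
    have xy: "x = restrict y ?V"
      using x by (auto simp: cube_def y_def restrict_def fun_eq_iff PiE_iff extensional_def)
    have sp: "signed_product d k x \<alpha> = signed_product d k y \<alpha>" if "\<alpha> \<in> ?K" for \<alpha>
      unfolding xy by (rule signed_product_restrict[OF assms that])
    show ?thesis
    proof (cases "\<exists>\<alpha> \<in> ?K. signed_product d k x \<alpha> \<noteq> 0")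
      \<comment> \<open>The polynomial evaluates to \<open>0\<close> here, and
        \<open>bsgn 0 = 1\<close> agrees with the default value of \<open>hard_fun\<close>.\<close>
      case False
      then show ?thesis
        by (simp add: hard_fun_no_leading p(3) bsgn_def)
    next
      case True
      then obtain \<alpha> where \<alpha>: "is_leading d k x \<alpha>"
        using is_leading_exists by blast
      then have mem: "\<alpha> \<in> ?K" and nz: "signed_product d k x \<alpha> \<noteq> 0"
        by (simp_all add: is_leading_def)
      let ?r = "\<Sum>\<beta> \<in> ?K - {\<alpha>}. N ^ rk \<beta> * signed_product d k x \<beta>"
      \<comment> \<open>The factor \<open>N\<close> on the left avoids division: a nonvanishing
        \<open>\<beta>\<close> has a rank at least one lower than \<open>\<alpha>\<close>.\<close>
      have bound: "\<bar>N ^ rk \<beta> * signed_product d k x \<beta>\<bar> * N \<le> 2 ^ d * N ^ rk \<alpha>"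
        if "\<beta> \<in> ?K - {\<alpha>}" for \<beta>
      proof (cases "signed_product d k x \<beta> = 0")
        case True
        then show ?thesis using N(1) by simp
      next
        case False
        then have "rk \<beta> < rk \<alpha>"
          using \<alpha> that rk_less unfolding is_leading_def by blast
        then have "N ^ Suc (rk \<beta>) \<le> N ^ rk \<alpha>"
          using N(1) by (intro power_increasing) auto
        moreover have "\<bar>signed_product d k x \<beta>\<bar> \<le> 2 ^ d"
          using sp[of \<beta>] that abs_signed_product_le[OF assms y] by simp
        ultimately have "N ^ Suc (rk \<beta>) * \<bar>signed_product d k x \<beta>\<bar> \<le> N ^ rk \<alpha> * 2 ^ d"
          using N(1) by (intro mult_mono) auto
        then show ?thesis
          using N(1) by (simp add: abs_mult power_abs ac_simps)
      qed
      have "\<bar>?r\<bar> * N \<le> (\<Sum>\<beta> \<in> ?K - {\<alpha>}. \<bar>N ^ rk \<beta> * signed_product d k x \<beta>\<bar> * N)"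
        using N(1) by (simp only: sum_distrib_right[symmetric]) (intro mult_right_mono sum_abs; simp)
      also have "\<dots> \<le> (\<Sum>\<beta> \<in> ?K - {\<alpha>}. 2 ^ d * N ^ rk \<alpha>)"
        by (rule sum_mono) (rule bound)
      also have "\<dots> = int (card (?K - {\<alpha>})) * (2 ^ d * N ^ rk \<alpha>)"
        by simp
      also have "\<dots> \<le> int (card ?K) * (2 ^ d * N ^ rk \<alpha>)"
        using N(1) finite_indices by (intro mult_right_mono) (auto intro: card_mono)
      also have "\<dots> = (2 ^ d * int (card ?K)) * N ^ rk \<alpha>"
        by simp
      also have "\<dots> < N * N ^ rk \<alpha>"
        using N by (intro mult_strict_right_mono) auto
      also have "\<dots> \<le> (N ^ rk \<alpha> * \<bar>signed_product d k x \<alpha>\<bar>) * N"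
        using N(1) nz by (simp add: ac_simps)
      finally have "\<bar>?r\<bar> < \<bar>N ^ rk \<alpha> * signed_product d k x \<alpha>\<bar>"
        using N(1) by (simp add: abs_mult power_abs)
      then have "bsgn (N ^ rk \<alpha> * signed_product d k x \<alpha> + ?r) = bsgn (N ^ rk \<alpha> * signed_product d k x \<alpha>)"
        by (rule bsgn_dominant)
      moreover have "mpoly_eval p x = N ^ rk \<alpha> * signed_product d k x \<alpha> + ?r"
        unfolding p(3) by (rule sum.remove[OF finite_indices mem])
      ultimately show ?thesis
        using N(1) by (simp add: hard_fun_leading[OF \<alpha>] bsgn_pos_mult)
    qed
  qed
  then show ?thesis
    using p(1,2) unfolding threshold_gate_def by blast
qed

section \<open>Antisymmetrisation\<close>

fun block :: "nat \<Rightarrow> var \<Rightarrow> nat" where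
  "block d (X i j) = i"
| "block d (Y j) = d"

fun position :: "var \<Rightarrow> nat" where
  "position (X i j) = j"
| "position (Y j) = j"

definition negate :: "nat \<Rightarrow> nat set \<Rightarrow> (var \<Rightarrow> int) \<Rightarrow> var \<Rightarrow> int" where
  "negate d S x v = (if block d v \<in> S then - x v else x v)"

fun swap_var :: "nat \<Rightarrow> var \<Rightarrow> var" where
  "swap_var d (X i j) = (if i = d then Y j else X i j)"
| "swap_var d (Y j) = X d j"

text \<open>Up to the scalar \<open>2 ^ d\<close>, the projection onto functions that change sign
  under negation of each block below \<open>d\<close> and under the swap of the two halves of block
  \<open>d\<close>.\<close>

definition antisymmetrise :: "nat \<Rightarrow> ((var \<Rightarrow> int) \<Rightarrow> int) \<Rightarrow> (var \<Rightarrow> int) \<Rightarrow> int" where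
  "antisymmetrise d g x =
     (\<Sum>S \<in> Pow {1..<d}. (- 1) ^ card S * (g (negate d S x) - g (negate d S x \<circ> swap_var d)))"

lemma block_swap_var [simp]: "block d (swap_var d v) = block d v"
  by (cases v) auto

lemma negate_swap: "negate d S x \<circ> swap_var d = negate d S (x \<circ> swap_var d)"
  by (auto simp: negate_def)

lemma signed_product_swap:
  "signed_product d k (x \<circ> swap_var d) \<alpha> = - signed_product d k x \<alpha>"
  unfolding signed_product_def by (simp add: algebra_simps cong: prod.cong_simp)

lemma linform_uminus: "linform K c (\<lambda>j. - z j) = - linform K c z"
  by (simp add: linform_def)

lemma signed_product_negate:
  assumes "S \<subseteq> {1..<d}"
  shows "signed_product d k (negate d S x) \<alpha> = (- 1) ^ card S * signed_product d k x \<alpha>"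
proof -
  have "(\<Prod>i = 1..<d. linform (k i) (\<alpha> i) (\<lambda>j. negate d S x (X i j))) =
    (\<Prod>i = 1..<d. (if i \<in> S then - 1 else 1) * linform (k i) (\<alpha> i) (\<lambda>j. x (X i j)))"
    by (rule prod.cong) (auto simp: negate_def linform_uminus)
  also have "\<dots> = (\<Prod>i = 1..<d. if i \<in> S then - 1 else 1) *
      (\<Prod>i = 1..<d. linform (k i) (\<alpha> i) (\<lambda>j. x (X i j)))"
    by (rule prod.distrib)
  also have "(\<Prod>i = 1..<d. if i \<in> S then - 1 else (1 :: int)) = (- 1) ^ card S"
    using assms by (simp add: prod.If_cases Int_absorb1)
  finally have "(\<Prod>i = 1..<d. linform (k i) (\<alpha> i) (\<lambda>j. negate d S x (X i j))) =
    (- 1) ^ card S * (\<Prod>i = 1..<d. linform (k i) (\<alpha> i) (\<lambda>j. x (X i j)))" .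
  moreover have "d \<notin> S"
    using assms by auto
  ultimately show ?thesis
    by (simp add: signed_product_def negate_def)
qed

text \<open>As \<open>c * s\<close> is nonzero, exactly one of \<open>a\<close> and \<open>b\<close>
  is nonnegative, so their difference has a strict sign even if one of them is
  \<open>0\<close>.\<close>

lemma bsgn_diff_pos:
  assumes "bsgn a = bsgn (c * s)" "bsgn b = bsgn (- (c * s))" "c = 1 \<or> c = - 1" "s \<noteq> 0"
  shows "0 < sgn s * (c * (a - b))"
  using assms by (auto simp: bsgn_def sgn_if split: if_splits)

text \<open>Each symmetry multiplies all products by one common sign, and the antisymmetrisation
  compensates for it. Thus every summand has the sign of the leading product and nothing
  cancels.\<close>

lemma sgn_antisymmetrise_gate:
  assumes "d \<ge> 1" "threshold_gate (input_vars d k) (hard_fun d k) p" "\<And>v. x v \<in> {- 1, 1}"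
    and "is_leading d k x \<alpha>"
  shows "sgn (antisymmetrise d (mpoly_eval p) x) = sgn (signed_product d k x \<alpha>)"
proof -
  let ?s = "signed_product d k x \<alpha>"
  have s: "?s \<noteq> 0"
    using assms(4) by (simp add: is_leading_def)
  have gate: "bsgn (mpoly_eval p y) = bsgn (c * ?s)"
    if "\<And>v. y v \<in> {- 1, 1}" "c \<noteq> 0" "\<And>\<beta>. signed_product d k y \<beta> = c * signed_product d k x \<beta>" for y c
    using threshold_gate_total[OF assms(1,2) that(1)] hard_fun_scaled[OF assms(4) that(2,3)] by simp
  have "0 < sgn ?s * ((- 1) ^ card S *
      (mpoly_eval p (negate d S x) - mpoly_eval p (negate d S x \<circ> swap_var d)))"
    if S: "S \<in> Pow {1..<d}" for S
  proof (rule bsgn_diff_pos)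
    have n: "negate d S x v \<in> {- 1, 1}" for v
      using assms(3)[of v] by (auto simp: negate_def)
    show "bsgn (mpoly_eval p (negate d S x)) = bsgn ((- 1) ^ card S * ?s)"
      using S by (intro gate n signed_product_negate) auto
    have "bsgn (mpoly_eval p (negate d S x \<circ> swap_var d)) = bsgn (- ((- 1) ^ card S) * ?s)"
      using S n by (intro gate) (auto simp: signed_product_swap signed_product_negate)
    then show "bsgn (mpoly_eval p (negate d S x \<circ> swap_var d)) = bsgn (- ((- 1) ^ card S * ?s))"
      by simp
    show "(- 1 :: int) ^ card S = 1 \<or> (- 1 :: int) ^ card S = - 1"
      by (cases "even (card S)") simp_all
  qed (rule s)
  then have "0 < (\<Sum>S \<in> Pow {1..<d}. sgn ?s * ((- 1) ^ card S *
      (mpoly_eval p (negate d S x) - mpoly_eval p (negate d S x \<circ> swap_var d))))"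
    by (intro sum_pos) auto
  then have "0 < sgn ?s * antisymmetrise d (mpoly_eval p) x"
    by (simp add: antisymmetrise_def sum_distrib_left)
  then show ?thesis
    by (auto simp: sgn_if split: if_splits)
qed

lemma abs_antisymmetrise_le_weight:
  assumes "d \<ge> 1" "\<And>v. x v \<in> {- 1, 1}"
  shows "\<bar>antisymmetrise d (mpoly_eval p) x\<bar> \<le> 2 ^ d * int (mpoly_weight p)"
proof -
  let ?W = "int (mpoly_weight p)"
  have "\<bar>antisymmetrise d (mpoly_eval p) x\<bar> \<le> (\<Sum>S \<in> Pow {1..<d}. 2 * ?W)"
    unfolding antisymmetrise_def
  proof (rule order_trans[OF sum_abs], rule sum_mono)
    fix S
    have n: "negate d S x v \<in> {- 1, 1}" for v
      using assms(2)[of v] by (auto simp: negate_def)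
    have "\<bar>mpoly_eval p (negate d S x)\<bar> \<le> ?W" "\<bar>mpoly_eval p (negate d S x \<circ> swap_var d)\<bar> \<le> ?W"
      using n by (intro abs_mpoly_eval_le_weight; simp)+
    then show "\<bar>(- 1) ^ card S * (mpoly_eval p (negate d S x) - mpoly_eval p (negate d S x \<circ> swap_var d))\<bar>
        \<le> 2 * ?W"
      by (simp add: abs_mult power_abs)
  qed
  also have "\<dots> = 2 ^ (d - 1) * 2 * ?W"
    by (simp add: card_Pow)
  also have "2 ^ (d - 1) * 2 = (2 :: int) ^ d"
    using assms(1) by (simp add: power_eq_if)
  finally show ?thesis .
qed

section \<open>The multilinear form of a gate\<close>

definition diff_blocks :: "nat \<Rightarrow> (var \<Rightarrow> int) \<Rightarrow> nat \<Rightarrow> nat \<Rightarrow> int" where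
  "diff_blocks d x i j = (if i = d then x (X d j) - x (Y j) else x (X i j))"

text \<open>A single identity expresses both additivity and homogeneity in a block.\<close>

definition multilinear :: "nat \<Rightarrow> ((nat \<Rightarrow> nat \<Rightarrow> int) \<Rightarrow> int) \<Rightarrow> bool" where
  "multilinear d T \<longleftrightarrow> (\<forall>u i a b c. i \<in> {1..d} \<longrightarrow>
     T (u(i := \<lambda>j. c * a j + b j)) = c * T (u(i := a)) + T (u(i := b)))"

lemma multilinearD:
  assumes "multilinear d T" "1 \<le> i" "i \<le> d"
  shows "T (u(i := \<lambda>j. c * a j + b j)) = c * T (u(i := a)) + T (u(i := b))"
  using assms by (simp add: multilinear_def)

lemma multilinear_sum:
  assumes "\<And>m. m \<in> A \<Longrightarrow> multilinear d (T m)"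
  shows "multilinear d (\<lambda>u. \<Sum>m \<in> A. c m * T m u)"
  using assms
  by (simp add: multilinear_def sum.distrib[symmetric] sum_distrib_left algebra_simps)

lemma multilinear_prod: "multilinear d (\<lambda>u. C * (\<Prod>i = 1..d. u i (\<pi> i)))"
  unfolding multilinear_def
proof (intro allI impI)
  fix u :: "nat \<Rightarrow> nat \<Rightarrow> int" and l a b and c :: int
  assume l: "l \<in> {1..d}"
  have upd: "(\<Prod>i = 1..d. (u(l := e)) i (\<pi> i)) = e (\<pi> l) * (\<Prod>i \<in> {1..d} - {l}. u i (\<pi> i))" for e
    by (subst prod.remove[OF _ l]) (auto intro!: prod.cong)
  show "C * (\<Prod>i = 1..d. (u(l := \<lambda>j. c * a j + b j)) i (\<pi> i)) =
      c * (C * (\<Prod>i = 1..d. (u(l := a)) i (\<pi> i))) + C * (\<Prod>i = 1..d. (u(l := b)) i (\<pi> i))"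
    unfolding upd by (simp add: algebra_simps)
qed

lemma multilinear_zero:
  assumes "multilinear d T" "1 \<le> i" "i \<le> d"
  shows "T (u(i := \<lambda>j. 0)) = 0"
  using multilinearD[OF assms, of u 1 "\<lambda>j. 0" "\<lambda>j. 0"] by simp

lemma multilinear_combination:
  assumes "multilinear d T" "1 \<le> i" "i \<le> d" "finite A"
  shows "T (u(i := \<lambda>j. \<Sum>m \<in> A. c m * a m j)) = (\<Sum>m \<in> A. c m * T (u(i := a m)))"
  using assms(4)
proof (induction A rule: finite_induct)
  case empty
  then show ?case
    using multilinear_zero[OF assms(1-3)] by (simp del: fun_upd_apply)
next
  case (insert m A)
  then show ?case
    using multilinearD[OF assms(1-3), of u "c m" "a m" "\<lambda>j. \<Sum>m \<in> A. c m * a m j"] by (simp del: fun_upd_apply)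
qed

text \<open>The value of \<open>m\<close> at the vector that is \<open>-1\<close> exactly on block
  \<open>i\<close> is the parity sign of the degree of \<open>m\<close> in that block.\<close>

lemma monom_eval_negate:
  assumes "finite S"
  shows "monom_eval m (negate d S x) =
    (\<Prod>i \<in> S. monom_eval m (\<lambda>v. if block d v = i then - 1 else 1)) * monom_eval m x"
proof -
  have "negate d S x v = (\<Prod>i \<in> S. if block d v = i then - 1 else 1) * x v" for v
    using assms by (simp add: negate_def)
  then have "monom_eval m (negate d S x) = (\<Prod>v \<in> Poly_Mapping.keys m.
      \<Prod>i \<in> S. (if block d v = i then - 1 else 1) ^ Poly_Mapping.lookup m v) * monom_eval m x"
    by (simp add: monom_eval_def power_mult_distrib prod.distrib prod_power_distrib)
  also have "(\<Prod>v \<in> Poly_Mapping.keys m.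
      \<Prod>i \<in> S. (if block d v = i then - 1 else (1 :: int)) ^ Poly_Mapping.lookup m v) =
    (\<Prod>i \<in> S. monom_eval m (\<lambda>v. if block d v = i then - 1 else 1))"
    unfolding monom_eval_def by (rule prod.swap)
  finally show ?thesis .
qed

text \<open>The alternating sum over subsets is the expanded form of a product with one factor per
  block below \<open>d\<close>.\<close>

lemma antisymmetrise_monom_eval:
  "antisymmetrise d (monom_eval m) x =
    (\<Prod>i = 1..<d. 1 - monom_eval m (\<lambda>v. if block d v = i then - 1 else 1)) *
    (monom_eval m x - monom_eval m (x \<circ> swap_var d))"
proof -
  let ?e = "\<lambda>i. monom_eval m (\<lambda>v. if block d v = i then - 1 else 1)"
  have "antisymmetrise d (monom_eval m) x = (\<Sum>S \<in> Pow {1..<d}. (\<Prod>i \<in> S. - ?e i) *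
      (monom_eval m x - monom_eval m (x \<circ> swap_var d)))"
    unfolding antisymmetrise_def
  proof (rule sum.cong[OF refl])
    fix S assume "S \<in> Pow {1..<d}"
    then have "finite S"
      using finite_subset by auto
    have "(\<Prod>i \<in> S. - ?e i) = (- 1) ^ card S * (\<Prod>i \<in> S. ?e i)"
      by (rule prod_uminus)
    then show "(- 1) ^ card S *
        (monom_eval m (negate d S x) - monom_eval m (negate d S x \<circ> swap_var d)) =
      (\<Prod>i \<in> S. - ?e i) * (monom_eval m x - monom_eval m (x \<circ> swap_var d))"
      unfolding negate_swap monom_eval_negate[OF \<open>finite S\<close>] by (simp add: algebra_simps)
  qed
  \<comment> \<open>The trivial product of ones gives the shape in which \<open>prod_add\<close>
    expands a product of sums.\<close>
  also have "\<dots> = (\<Sum>S \<in> Pow {1..<d}. (\<Prod>i \<in> S. - ?e i) * (\<Prod>i \<in> {1..<d} - S. 1)) *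
      (monom_eval m x - monom_eval m (x \<circ> swap_var d))"
    by (simp add: sum_distrib_right)
  also have "(\<Sum>S \<in> Pow {1..<d}. (\<Prod>i \<in> S. - ?e i) * (\<Prod>i \<in> {1..<d} - S. 1)) =
      (\<Prod>i = 1..<d. - ?e i + 1)"
    by (rule prod_add[symmetric]) simp
  finally show ?thesis
    by (simp add: o_def)
qed

text \<open>If block \<open>d\<close> is missing, the swap fixes the monomial; if a lower block is
  missing, its parity sign is \<open>1\<close> and its factor vanishes.\<close>

lemma antisymmetrise_monom_eval_missing:
  assumes "l \<in> {1..d}" "\<And>v. v \<in> Poly_Mapping.keys m \<Longrightarrow> block d v \<noteq> l"
  shows "antisymmetrise d (monom_eval m) x = 0"
proof (cases "l = d")
  case True
  have "swap_var d v = v" if "v \<in> Poly_Mapping.keys m" for v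
    using assms(2)[OF that] True by (cases v) auto
  then have "monom_eval m (x \<circ> swap_var d) = monom_eval m x"
    unfolding monom_eval_def by (intro prod.cong) auto
  then show ?thesis
    by (simp add: antisymmetrise_monom_eval)
next
  case False
  have "monom_eval m (\<lambda>v. if block d v = l then - 1 else 1) = 1"
    unfolding monom_eval_def by (rule prod.neutral) (simp add: assms(2))
  then have "(\<Prod>i = 1..<d. 1 - monom_eval m (\<lambda>v. if block d v = i then - 1 else 1)) = 0"
    using assms(1) False by (intro prod_zero) (auto intro!: bexI[of _ l])
  then show ?thesis
    by (simp add: antisymmetrise_monom_eval)
qed

text \<open>The chosen variables lie in different blocks, so they are \<open>d\<close> distinct
  ones. Degree at most \<open>d\<close> then leaves no room for a further variable or for an
  exponent above \<open>1\<close>.\<close>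

lemma monom_degree_transversal:
  assumes "\<And>i. i \<in> {1..d} \<Longrightarrow> \<nu> i \<in> Poly_Mapping.keys m \<and> block d (\<nu> i) = i"
  shows "d \<le> monom_degree m"
    and "monom_degree m \<le> d \<Longrightarrow> monom_eval m x = (\<Prod>i = 1..d. x (\<nu> i))"
proof -
  let ?R = "\<nu> ` {1..d}" and ?L = "Poly_Mapping.lookup m"
  have inj: "inj_on \<nu> {1..d}"
    using assms by (metis inj_onI)
  have R: "?R \<subseteq> Poly_Mapping.keys m"
    using assms by auto
  have pos: "1 \<le> ?L v" if "v \<in> Poly_Mapping.keys m" for v
    using that by (simp add: in_keys_iff)
  have card: "(\<Sum>v \<in> ?R. 1) = d"
    using inj by (simp add: card_image)
  have split: "monom_degree m = sum ?L ?R + sum ?L (Poly_Mapping.keys m - ?R)"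
    unfolding monom_degree_def by (subst sum.subset_diff[OF R]) simp_all
  have low: "d \<le> sum ?L ?R"
    using sum_mono[of ?R "\<lambda>_. 1" ?L] pos R card by (metis subsetD)
  show "d \<le> monom_degree m"
    using split low by simp
  show "monom_eval m x = (\<Prod>i = 1..d. x (\<nu> i))" if "monom_degree m \<le> d"
  proof -
    have zero: "sum ?L (Poly_Mapping.keys m - ?R) = 0" and eq: "sum ?L ?R = d"
      using split low that by linarith+
    have keys: "Poly_Mapping.keys m = ?R"
    proof (rule ccontr)
      assume "Poly_Mapping.keys m \<noteq> ?R"
      then obtain v where v: "v \<in> Poly_Mapping.keys m - ?R"
        using R by blast
      then have "?L v = 0"
        using zero by (meson finite_Diff finite_keys sum_eq_0_iff)
      then show False
        using v by (simp add: in_keys_iff)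
    qed
    have one: "?L v = 1" if "v \<in> ?R" for v
    proof (rule ccontr)
      assume "?L v \<noteq> 1"
      then have "1 < ?L v"
        using pos R that by (metis le_neq_implies_less subsetD)
      then have "(\<Sum>v \<in> ?R. 1) < sum ?L ?R"
        using pos R that by (intro sum_strict_mono_ex1) (auto intro!: bexI[of _ v])
      then show False
        using card eq by simp
    qed
    have "monom_eval m x = (\<Prod>v \<in> ?R. x v)"
      unfolding monom_eval_def keys by (rule prod.cong) (simp_all add: one)
    then show ?thesis
      using inj by (simp add: prod.reindex)
  qed
qed

lemma antisymmetrise_monom_eval_low_degree:
  assumes "monom_degree m < d"
  shows "antisymmetrise d (monom_eval m) x = 0"
proof (rule ccontr)
  assume "antisymmetrise d (monom_eval m) x \<noteq> 0"
  then have "\<forall>i \<in> {1..d}. \<exists>v. v \<in> Poly_Mapping.keys m \<and> block d v = i"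
    using antisymmetrise_monom_eval_missing by blast
  then obtain \<nu> where "\<And>i. i \<in> {1..d} \<Longrightarrow> \<nu> i \<in> Poly_Mapping.keys m \<and> block d (\<nu> i) = i"
    by metis
  then show False
    using monom_degree_transversal(1)[of d \<nu> m] assms by simp
qed

text \<open>If a block is missed, the zero form serves. Otherwise the monomial has exactly one
  variable per block, and subtracting the swapped monomial turns the last one into a difference of
  the two halves.\<close>

lemma antisymmetrise_monom_eval_multilinear:
  assumes "d \<ge> 1" "monom_degree m \<le> d"
  shows "\<exists>T. multilinear d T \<and> (\<forall>x. antisymmetrise d (monom_eval m) x = T (diff_blocks d x))"
proof (cases "\<forall>i \<in> {1..d}. \<exists>v. v \<in> Poly_Mapping.keys m \<and> block d v = i")
  case False
  then obtain l where "l \<in> {1..d}" "\<And>v. v \<in> Poly_Mapping.keys m \<Longrightarrow> block d v \<noteq> l"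
    by blast
  then have "antisymmetrise d (monom_eval m) x = 0" for x
    by (rule antisymmetrise_monom_eval_missing)
  then show ?thesis
    by (intro exI[of _ "\<lambda>_. 0"]) (simp add: multilinear_def)
next
  case True
  then obtain \<nu> where \<nu>: "\<And>i. i \<in> {1..d} \<Longrightarrow> \<nu> i \<in> Poly_Mapping.keys m \<and> block d (\<nu> i) = i"
    by metis
  \<comment> \<open>Records which half of block \<open>d\<close> the variable comes from: for a
    \<open>Y\<close> variable the difference appears negated.\<close>
  define s :: int where "s = (if \<nu> d = X d (position (\<nu> d)) then 1 else - 1)"
  let ?C = "\<Prod>i = 1..<d. 1 - monom_eval m (\<lambda>v. if block d v = i then - 1 else 1)"
  have set: "{1..d} = insert d {1..<d}"
    using assms(1) by auto
  have low: "\<nu> i = X i (position (\<nu> i))" if "i \<in> {1..<d}" for i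
    using \<nu>[of i] that by (cases "\<nu> i") auto
  have "antisymmetrise d (monom_eval m) x = ?C * s * (\<Prod>i = 1..d. diff_blocks d x i (position (\<nu> i)))" for x
  proof -
    have ev: "monom_eval m y = y (\<nu> d) * (\<Prod>i = 1..<d. y (\<nu> i))" for y
      using monom_degree_transversal(2)[OF \<nu> assms(2)] unfolding set by simp
    have "x (\<nu> d) - x (swap_var d (\<nu> d)) = s * diff_blocks d x d (position (\<nu> d))"
      using \<nu>[of d] assms(1) by (cases "\<nu> d") (auto simp: s_def diff_blocks_def)
    moreover have "(\<Prod>i = 1..<d. x (\<nu> i)) = (\<Prod>i = 1..<d. diff_blocks d x i (position (\<nu> i)))"
      by (rule prod.cong) (use low in \<open>auto simp: diff_blocks_def\<close>)
    moreover have "(\<Prod>i = 1..<d. x (swap_var d (\<nu> i))) = (\<Prod>i = 1..<d. x (\<nu> i))"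
    proof (rule prod.cong[OF refl])
      fix i assume i: "i \<in> {1..<d}"
      then show "x (swap_var d (\<nu> i)) = x (\<nu> i)"
        by (subst (1 2) low[OF i]) simp
    qed
    ultimately show ?thesis
      unfolding antisymmetrise_monom_eval ev unfolding set by (simp add: left_diff_distrib[symmetric])
  qed
  then show ?thesis
    using multilinear_prod[of d "?C * s" "\<lambda>i. position (\<nu> i)"] by blast
qed

lemma antisymmetrise_mpoly_eval:
  "antisymmetrise d (mpoly_eval p) x =
    (\<Sum>m \<in> Poly_Mapping.keys p. Poly_Mapping.lookup p m * antisymmetrise d (monom_eval m) x)"
  unfolding antisymmetrise_def mpoly_eval_monom_eval sum_subtractf[symmetric] sum_distrib_left
  by (subst sum.swap) (simp add: algebra_simps)

lemma antisymmetrise_low_degree: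
  assumes "mpoly_degree p < d"
  shows "antisymmetrise d (mpoly_eval p) x = 0"
proof -
  have "monom_degree m < d" if "m \<in> Poly_Mapping.keys p" for m
    using that assms mpoly_degree_le_iff[of p "mpoly_degree p"] by auto
  then show ?thesis
    by (simp add: antisymmetrise_mpoly_eval antisymmetrise_monom_eval_low_degree)
qed

lemma antisymmetrise_multilinear:
  assumes "d \<ge> 1" "mpoly_degree p \<le> d"
  obtains T where "multilinear d T" "\<And>x. antisymmetrise d (mpoly_eval p) x = T (diff_blocks d x)"
proof -
  have "\<forall>m \<in> Poly_Mapping.keys p. \<exists>T. multilinear d T \<and>
      (\<forall>x. antisymmetrise d (monom_eval m) x = T (diff_blocks d x))"
    using assms antisymmetrise_monom_eval_multilinear by (auto simp: mpoly_degree_le_iff)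
  then obtain T where T: "\<And>m. m \<in> Poly_Mapping.keys p \<Longrightarrow> multilinear d (T m)"
    "\<And>m x. m \<in> Poly_Mapping.keys p \<Longrightarrow> antisymmetrise d (monom_eval m) x = T m (diff_blocks d x)"
    by metis
  show ?thesis
  proof (rule that)
    show "multilinear d (\<lambda>u. \<Sum>m \<in> Poly_Mapping.keys p. Poly_Mapping.lookup p m * T m u)"
      using T(1) by (rule multilinear_sum)
  qed (simp add: antisymmetrise_mpoly_eval T(2))
qed

section \<open>Test points\<close>

text \<open>The sign vector on which form \<open>a\<close> has value \<open>2\<close> and all others
  vanish.\<close>

definition unit_row :: "nat \<Rightarrow> nat \<Rightarrow> int" where
  "unit_row a j = (if a = 0 \<or> j \<le> a then 1 else - 1)"

definition unit_diff :: "nat \<Rightarrow> nat \<Rightarrow> int" where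
  "unit_diff a j = (if j = a then 2 else 0)"

definition unit_blocks :: "nat \<Rightarrow> (nat \<Rightarrow> nat) \<Rightarrow> nat \<Rightarrow> nat \<Rightarrow> int" where
  "unit_blocks d \<alpha> i = (if i = d then unit_diff (\<alpha> i) else unit_row (\<alpha> i))"

definition admissible :: "nat \<Rightarrow> (nat \<Rightarrow> nat \<Rightarrow> int) \<Rightarrow> bool" where
  "admissible d u \<longleftrightarrow> (\<forall>i j. u i j \<in> (if i = d then {- 2, 0, 2} else {- 1, 1}))"

text \<open>A right inverse of \<open>diff_blocks\<close> on admissible block values; where the
  difference is \<open>0\<close>, both halves are \<open>-1\<close>.\<close>

fun blocks_point :: "nat \<Rightarrow> (nat \<Rightarrow> nat \<Rightarrow> int) \<Rightarrow> var \<Rightarrow> int" where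
  "blocks_point d u (X i j) = (if i = d then if u d j = 2 then 1 else - 1 else u i j)"
| "blocks_point d u (Y j) = (if u d j = - 2 then 1 else - 1)"

definition block_product :: "nat \<Rightarrow> (nat \<Rightarrow> nat) \<Rightarrow> (nat \<Rightarrow> nat \<Rightarrow> int) \<Rightarrow> (nat \<Rightarrow> nat) \<Rightarrow> int" where
  "block_product d k u \<alpha> = (- 1) ^ (\<Sum>i = 1..<d. sign_exp k \<alpha> i) *
     (\<Prod>i = 1..<d. linform (k i) (\<alpha> i) (u i)) * u d (\<alpha> d)"

lemma linform_unit_row:
  assumes "c < K" "a < K"
  shows "linform K c (unit_row a) = (if c = a then 2 else 0)"
  using assms by (auto simp: linform_def unit_row_def)

text \<open>This combination is again a sign vector: it is \<open>-1\<close> at the positions after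
  \<open>a\<close> up to \<open>b\<close>, and \<open>1\<close> elsewhere.\<close>

lemma linform_three_rows:
  assumes "c < K" "1 \<le> a" "a < b" "b < K"
  shows "linform K c (\<lambda>j. - 1 * unit_row b j + (1 * unit_row a j + unit_row 0 j)) =
    (if c = 0 \<or> c = a then 2 else if c = b then - 2 else 0)"
  using assms by (auto simp: linform_def unit_row_def)

lemma unit_blocks_upd:
  "l \<noteq> d \<Longrightarrow> unit_blocks d (\<alpha>(l := a)) = (unit_blocks d \<alpha>)(l := unit_row a)"
  "unit_blocks d (\<alpha>(d := a)) = (unit_blocks d \<alpha>)(d := unit_diff a)"
  by (auto simp: unit_blocks_def fun_eq_iff)

lemma admissible_unit_blocks: "admissible d (unit_blocks d \<alpha>)"
  by (auto simp: admissible_def unit_blocks_def unit_row_def unit_diff_def)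

lemma admissible_upd:
  assumes "admissible d u" "\<And>j. a j \<in> (if i = d then {- 2, 0, 2} else {- 1, 1})"
  shows "admissible d (u(i := a))"
  using assms unfolding admissible_def by (metis fun_upd_apply)

lemma blocks_point_mem: "admissible d u \<Longrightarrow> blocks_point d u v \<in> {- 1, 1}"
  by (cases v) (auto simp: admissible_def split: if_splits)

lemma diff_blocks_point:
  assumes "admissible d u"
  shows "diff_blocks d (blocks_point d u) = u"
proof (intro ext)
  fix i j
  have "u d j \<in> {- 2, 0, 2}"
    using assms unfolding admissible_def by presburger
  then show "diff_blocks d (blocks_point d u) i j = u i j"
    by (auto simp: diff_blocks_def)
qed

lemma signed_product_point:
  assumes "admissible d u"
  shows "signed_product d k (blocks_point d u) \<alpha> = block_product d k u \<alpha>"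
proof -
  have "blocks_point d u (X d j) - blocks_point d u (Y j) = u d j" for j
    using fun_cong[OF fun_cong[OF diff_blocks_point[OF assms], of d], of j]
    by (simp add: diff_blocks_def)
  then show ?thesis
    by (simp add: signed_product_def block_product_def)
qed

lemma ord_idx_01: "ord_idx k \<alpha> l = 0 \<or> ord_idx k \<alpha> l = 1"
  by (induction k \<alpha> l rule: ord_idx.induct) auto

lemma block_product_nonzeroD:
  assumes "block_product d k u \<alpha> \<noteq> 0"
  shows "1 \<le> i \<Longrightarrow> i < d \<Longrightarrow> linform (k i) (\<alpha> i) (u i) \<noteq> 0" and "u d (\<alpha> d) \<noteq> 0"
  using assms unfolding block_product_def by auto

section \<open>Growth along the snake order\<close>

text \<open>What the growth argument uses of a gate: multilinearity, and at each admissible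
  \<open>u\<close> the sign of the leading product, in terms of block values instead of
  inputs.\<close>

locale signing_form =
  fixes d :: nat and k :: "nat \<Rightarrow> nat" and T :: "(nat \<Rightarrow> nat \<Rightarrow> int) \<Rightarrow> int"
  assumes d: "d \<ge> 1"
    and k: "\<And>i. i \<in> {1..<d} \<Longrightarrow> k i \<ge> 3 \<and> odd (k i)" "k d \<ge> 3"
    and T: "multilinear d T"
    and sgn_T: "\<And>u \<alpha>. admissible d u \<Longrightarrow> \<alpha> \<in> indices d k \<Longrightarrow> block_product d k u \<alpha> \<noteq> 0 \<Longrightarrow>
      (\<And>\<beta>. \<beta> \<in> indices d k \<Longrightarrow> block_product d k u \<beta> \<noteq> 0 \<Longrightarrow> \<beta> \<noteq> \<alpha> \<Longrightarrow> index_less d k \<beta> \<alpha>) \<Longrightarrow>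
      sgn (T u) = sgn (block_product d k u \<alpha>)"
begin

abbreviation V :: "(nat \<Rightarrow> nat) \<Rightarrow> int" where
  "V \<alpha> \<equiv> T (unit_blocks d \<alpha>)"

definition inner :: "(nat \<Rightarrow> nat) \<Rightarrow> bool" where
  "inner \<alpha> \<longleftrightarrow> \<alpha> \<in> indices d k \<and> (\<forall>i \<in> {1..<d}. 1 \<le> \<alpha> i)"

lemma indices_ext:
  assumes "\<alpha> \<in> indices d k" "\<beta> \<in> indices d k" "\<And>i. 1 \<le> i \<Longrightarrow> i \<le> d \<Longrightarrow> \<alpha> i = \<beta> i"
  shows "\<alpha> = \<beta>"
  by (rule PiE_ext[OF assms(1,2)[unfolded indices_def]]) (use assms(3) in auto)

text \<open>Only the product of \<open>\<alpha>\<close> survives at this point, so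
  \<open>\<alpha>\<close> is leading; its forms are positive, and the sign comes from
  \<open>sign_exp\<close> alone.\<close>

lemma sgn_V:
  assumes \<alpha>: "\<alpha> \<in> indices d k"
  shows "sgn (V \<alpha>) = (- 1) ^ (\<Sum>i = 1..<d. sign_exp k \<alpha> i)"
proof -
  have P: "(\<Prod>i = 1..<d. linform (k i) (\<alpha> i) (unit_blocks d \<alpha> i)) = 2 ^ (d - 1)"
    using indices_D(1)[OF \<alpha>] by (simp add: unit_blocks_def linform_unit_row)
  have bp: "block_product d k (unit_blocks d \<alpha>) \<alpha> =
      (- 1) ^ (\<Sum>i = 1..<d. sign_exp k \<alpha> i) * (2 ^ (d - 1) * 2)"
    unfolding block_product_def P by (simp add: unit_blocks_def unit_diff_def)
  have "sgn (V \<alpha>) = sgn (block_product d k (unit_blocks d \<alpha>) \<alpha>)"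
  proof (rule sgn_T[OF admissible_unit_blocks \<alpha>])
    show "block_product d k (unit_blocks d \<alpha>) \<alpha> \<noteq> 0"
      by (simp add: bp)
    fix \<beta> assume \<beta>: "\<beta> \<in> indices d k" "block_product d k (unit_blocks d \<alpha>) \<beta> \<noteq> 0" "\<beta> \<noteq> \<alpha>"
    have "\<beta> i = \<alpha> i" if "1 \<le> i" "i < d" for i
      using block_product_nonzeroD(1)[OF \<beta>(2) that] that indices_D(1)[OF \<beta>(1) that] indices_D(1)[OF \<alpha> that]
      by (simp add: unit_blocks_def linform_unit_row split: if_splits)
    moreover have "\<beta> d = \<alpha> d"
      using block_product_nonzeroD(2)[OF \<beta>(2)] by (simp add: unit_blocks_def unit_diff_def split: if_splits)
    ultimately have "\<beta> = \<alpha>"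
      by (intro indices_ext \<beta>(1) \<alpha>) (metis le_neq_implies_less)
    then show "index_less d k \<beta> \<alpha>"
      using \<beta>(3) by simp
  qed
  then show ?thesis
    unfolding bp by (cases "even (\<Sum>i = 1..<d. sign_exp k \<alpha> i)") simp_all
qed

lemma innerD:
  assumes "inner \<alpha>"
  shows "\<alpha> \<in> indices d k" "1 \<le> i \<Longrightarrow> i < d \<Longrightarrow> 1 \<le> \<alpha> i \<and> \<alpha> i < k i" "1 \<le> \<alpha> d" "\<alpha> d \<le> k d"
  using assms indices_D[of \<alpha> d k] d unfolding inner_def by auto

lemma inner_upd:
  assumes "inner \<alpha>" "1 \<le> l" "l \<le> d" "if l < d then 1 \<le> a \<and> a < k l else 1 \<le> a \<and> a \<le> k d"
  shows "inner (\<alpha>(l := a))"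
  using assms indices_upd[of \<alpha> d k l a] unfolding inner_def by (auto split: if_splits)

lemma V_pos:
  assumes "inner \<alpha>"
  shows "0 < V \<alpha>"
proof -
  have "(\<Sum>i = 1..<d. sign_exp k \<alpha> i) = 0"
    using assms unfolding inner_def by (auto simp: sign_exp_def)
  then have "sgn (V \<alpha>) = 1"
    using sgn_V[OF innerD(1)[OF assms]] by simp
  then show ?thesis
    by (simp add: sgn_1_pos)
qed

text \<open>By linearity the test point yields \<open>V\<close> at \<open>0\<close> plus
  \<open>V\<close> at \<open>a\<close> minus \<open>V\<close> at \<open>b\<close>. Its sign is that
  of the product for the later of \<open>a\<close> and \<open>b\<close>: positive for
  \<open>a\<close>, negative for \<open>b\<close>.\<close>

lemma V_row_step:
  assumes \<alpha>: "inner \<alpha>" and l: "1 \<le> l" "l < d" and ab: "1 \<le> a" "a < b" "b < k l"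
  shows "if ord_idx k \<alpha> l = 1 then V (\<alpha>(l := a)) < V (\<alpha>(l := b)) else V (\<alpha>(l := b)) < V (\<alpha>(l := a))"
proof -
  let ?i = "ord_idx k \<alpha> l"
  \<comment> \<open>In block \<open>l\<close> exactly the forms \<open>0\<close>, \<open>a\<close>, \<open>b\<close> are nonzero: a sign vector always has an odd number.\<close>
  define u where "u = (unit_blocks d \<alpha>)
    (l := \<lambda>j. - 1 * unit_row b j + (1 * unit_row a j + unit_row 0 j))"
  \<comment> \<open>The last of \<open>0\<close>, \<open>a\<close>, \<open>b\<close> in the order
    with index \<open>?i\<close>, as \<open>0\<close> comes first in both orders.\<close>
  define e where "e = (if ?i = 1 then b else a)"
  define \<mu> where "\<mu> = \<alpha>(l := e)"
  have ord: "ord_idx k (\<alpha>(l := c)) l = ?i" for c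
    by (rule ord_idx_cong) auto
  have \<mu>: "inner \<mu>"
    unfolding \<mu>_def using \<alpha> l ab by (intro inner_upd) (auto simp: e_def)
  have Tu: "T u = V (\<alpha>(l := 0)) + V (\<alpha>(l := a)) - V (\<alpha>(l := b))"
    unfolding u_def multilinearD[OF T l(1) less_imp_le[OF l(2)]] using l by (simp add: unit_blocks_upd)
  have u_l: "linform (k l) c (u l) = (if c = 0 \<or> c = a then 2 else if c = b then - 2 else 0)"
    if "c < k l" for c
    unfolding u_def using linform_three_rows[OF that ab] by simp
  have u_i: "u i = unit_row (\<alpha> i)" if "i \<noteq> l" "i \<noteq> d" for i
    using that by (simp add: u_def unit_blocks_def)
  have u_d: "u d = unit_diff (\<alpha> d)"
    using l by (simp add: u_def unit_blocks_def)
  have bp: "sgn (block_product d k u \<mu>) = (if ?i = 1 then - 1 else 1)"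
  proof -
    have "(\<Sum>i = 1..<d. sign_exp k \<mu> i) = 0"
      using \<mu> unfolding inner_def by (auto simp: sign_exp_def)
    then have "block_product d k u \<mu> = (\<Prod>i = 1..<d. linform (k i) (\<mu> i) (u i)) * 2"
      using l by (simp add: block_product_def u_d unit_diff_def \<mu>_def)
    also have "(\<Prod>i = 1..<d. linform (k i) (\<mu> i) (u i)) =
        linform (k l) e (u l) * (\<Prod>i \<in> {1..<d} - {l}. linform (k i) (\<mu> i) (u i))"
      using l by (subst prod.remove[of _ l]) (auto simp: \<mu>_def)
    finally have "block_product d k u \<mu> =
        linform (k l) e (u l) * (\<Prod>i \<in> {1..<d} - {l}. linform (k i) (\<mu> i) (u i)) * 2" .
    moreover have "0 < (\<Prod>i \<in> {1..<d} - {l}. linform (k i) (\<mu> i) (u i))"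
      using innerD(2)[OF \<alpha>] by (intro prod_pos) (auto simp: u_i \<mu>_def linform_unit_row)
    moreover have "linform (k l) e (u l) = (if ?i = 1 then - 2 else 2)"
      using ab by (subst u_l) (auto simp: e_def)
    ultimately show ?thesis
      by (simp add: sgn_mult)
  qed
  have "sgn (T u) = sgn (block_product d k u \<mu>)"
  proof (rule sgn_T)
    show "admissible d u"
      unfolding u_def using l ab
      by (intro admissible_upd admissible_unit_blocks) (auto simp: unit_row_def)
    show "\<mu> \<in> indices d k"
      using \<mu> by (rule innerD)
    show "block_product d k u \<mu> \<noteq> 0"
      using bp by (auto split: if_splits)
    fix \<beta> assume \<beta>: "\<beta> \<in> indices d k" "block_product d k u \<beta> \<noteq> 0" "\<beta> \<noteq> \<mu>"
    have eq: "\<beta> i = \<alpha> i" if "1 \<le> i" "i < d" "i \<noteq> l" for i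
      using block_product_nonzeroD(1)[OF \<beta>(2) that(1,2)] that indices_D(1)[OF \<beta>(1) that(1,2)]
        innerD(2)[OF \<alpha> that(1,2)]
      by (simp add: u_i linform_unit_row split: if_splits)
    have eq_d: "\<beta> d = \<alpha> d"
      using block_product_nonzeroD(2)[OF \<beta>(2)] by (simp add: u_d unit_diff_def split: if_splits)
    have \<beta>l: "\<beta> l = 0 \<or> \<beta> l = a \<or> \<beta> l = b"
      using block_product_nonzeroD(1)[OF \<beta>(2) l] u_l[OF indices_D(1)[OF \<beta>(1) l]] by (auto split: if_splits)
    have ne: "\<beta> l \<noteq> e"
    proof
      assume "\<beta> l = e"
      then have "\<beta> i = \<mu> i" if "1 \<le> i" "i \<le> d" for i
        using that eq[of i] eq_d by (cases "i = d"; cases "i = l") (auto simp: \<mu>_def)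
      then show False
        using \<beta>(3) indices_ext[OF \<beta>(1) innerD(1)[OF \<mu>]] by blast
    qed
    have "ord_idx k \<beta> l = ?i"
      by (rule ord_idx_cong) (use eq l in auto)
    then have "prec' (k l) (ord_idx k \<beta> l) (\<beta> l) (\<mu> l)"
      using \<beta>l ne ab by (auto simp: prec'_def num'_def \<mu>_def e_def split: if_splits)
    then show "index_less d k \<beta> \<mu>"
      unfolding index_less_def using l ne eq by (intro bexI[of _ l]) (auto simp: \<mu>_def)
  qed
  then have sgnT: "sgn (T u) = (if ?i = 1 then - 1 else 1)"
    by (simp add: bp)
  have "(\<Sum>i = 1..<d. sign_exp k (\<alpha>(l := 0)) i) = sign_exp k (\<alpha>(l := 0)) l"
    using l \<alpha> by (subst sum.remove[of _ l]) (auto simp: sign_exp_def inner_def Suc_le_eq)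
  also have "\<dots> = (if ?i = 0 then 1 else 0)"
    by (simp add: sign_exp_def ord del: fun_upd_apply) simp
  finally have "sgn (V (\<alpha>(l := 0))) = (- 1) ^ (if ?i = 0 then 1 else 0)"
    using sgn_V[OF indices_upd[OF innerD(1)[OF \<alpha>], of l 0]] l innerD(2)[OF \<alpha>, of l] by simp
  then show ?thesis
    using sgnT Tu ord_idx_01[of k \<alpha> l] by (auto simp: sgn_if split: if_splits)
qed

text \<open>With \<open>2\<close> at \<open>j\<close> and \<open>-2\<close> at all its predecessors
  in the last block, \<open>j\<close> leads with a positive product, while linearity evaluates
  \<open>T\<close> to the difference of the two sides.\<close>

lemma V_last_step:
  assumes \<alpha>: "inner \<alpha>" and j: "1 \<le> j" "j \<le> k d"
  shows "(\<Sum>m \<in> {m \<in> {1..k d}. prec (ord_idx k \<alpha> d) m j}. V (\<alpha>(d := m))) < V (\<alpha>(d := j))"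
proof -
  define A where "A = {m \<in> {1..k d}. prec (ord_idx k \<alpha> d) m j}"
  define c :: "nat \<Rightarrow> int" where "c m = (if m = j then 1 else - 1)" for m
  define u where "u = (unit_blocks d \<alpha>)(d := \<lambda>i. \<Sum>m \<in> insert j A. c m * unit_diff m i)"
  have A: "finite A" "j \<notin> A"
    by (auto simp: A_def prec_def split: if_splits)
  have \<mu>: "inner (\<alpha>(d := j))"
    using \<alpha> d j by (intro inner_upd) auto
  have "T u = (\<Sum>m \<in> insert j A. c m * V (\<alpha>(d := m)))"
    unfolding u_def unit_blocks_upd(2) by (rule multilinear_combination) (use T d A in auto)
  also have "\<dots> = V (\<alpha>(d := j)) + (\<Sum>m \<in> A. c m * V (\<alpha>(d := m)))"
    using A by (simp add: c_def del: fun_upd_apply)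
  also have "(\<Sum>m \<in> A. c m * V (\<alpha>(d := m))) = (\<Sum>m \<in> A. - V (\<alpha>(d := m)))"
    by (rule sum.cong) (use A in \<open>auto simp: c_def\<close>)
  finally have Tu: "T u = V (\<alpha>(d := j)) - (\<Sum>m \<in> A. V (\<alpha>(d := m)))"
    by (simp add: sum_negf del: fun_upd_apply)
  have u_d: "u d i = (if i = j then 2 else if i \<in> A then - 2 else 0)" for i
  proof -
    have "u d i = (\<Sum>m \<in> insert j A. if i = m then 2 * c m else 0)"
      unfolding u_def by (auto simp: unit_diff_def intro!: sum.cong)
    also have "\<dots> = (if i \<in> insert j A then 2 * c i else 0)"
      using A by (intro sum.delta') auto
    finally show ?thesis
      using A by (auto simp: c_def)
  qed
  have u_i: "u i = unit_row (\<alpha> i)" if "i \<noteq> d" for i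
    using that by (simp add: u_def unit_blocks_def)
  have "sgn (T u) = sgn (block_product d k u (\<alpha>(d := j)))"
  proof (rule sgn_T)
    show "admissible d u"
      using admissible_unit_blocks[of d \<alpha>] u_d unfolding admissible_def
      by (auto simp: u_i unit_row_def)
    show "\<alpha>(d := j) \<in> indices d k"
      using \<mu> by (rule innerD)
    show "block_product d k u (\<alpha>(d := j)) \<noteq> 0"
      using innerD(2)[OF \<alpha>] by (auto simp: block_product_def u_d u_i linform_unit_row)
    fix \<beta> assume \<beta>: "\<beta> \<in> indices d k" "block_product d k u \<beta> \<noteq> 0" "\<beta> \<noteq> \<alpha>(d := j)"
    have eq: "\<beta> i = \<alpha> i" if "1 \<le> i" "i < d" for i
      using block_product_nonzeroD(1)[OF \<beta>(2) that] that indices_D(1)[OF \<beta>(1) that] innerD(2)[OF \<alpha> that]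
      by (simp add: u_i linform_unit_row split: if_splits)
    have "\<beta> d \<noteq> j"
    proof
      assume "\<beta> d = j"
      then have "\<beta> i = (\<alpha>(d := j)) i" if "1 \<le> i" "i \<le> d" for i
        using that eq[of i] by (cases "i = d") auto
      then show False
        using \<beta>(3) indices_ext[OF \<beta>(1) innerD(1)[OF \<mu>]] by blast
    qed
    moreover from this have "\<beta> d \<in> A"
      using block_product_nonzeroD(2)[OF \<beta>(2)] by (simp add: u_d split: if_splits)
    moreover have "ord_idx k \<beta> d = ord_idx k \<alpha> d"
      by (rule ord_idx_cong) (use eq in auto)
    ultimately show "index_less d k \<beta> (\<alpha>(d := j))"
      unfolding index_less_def using d eq by (intro bexI[of _ d]) (auto simp: A_def)
  qed
  moreover have "0 < block_product d k u (\<alpha>(d := j))"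
  proof -
    have "(\<Sum>i = 1..<d. sign_exp k (\<alpha>(d := j)) i) = 0"
      using \<mu> unfolding inner_def by (auto simp: sign_exp_def)
    moreover have "0 < (\<Prod>i = 1..<d. linform (k i) ((\<alpha>(d := j)) i) (u i))"
      using innerD(2)[OF \<alpha>] by (intro prod_pos) (auto simp: u_i linform_unit_row)
    ultimately show ?thesis
      by (simp add: block_product_def u_d)
  qed
  ultimately have "0 < T u"
    by (simp add: sgn_1_pos)
  then show ?thesis
    using Tu by (simp add: A_def)
qed

section \<open>Traversal of the levels and accumulated growth\<close>

definition top_elem :: "nat \<Rightarrow> nat" where
  "top_elem l = (if l < d then k l - 1 else k d)"

text \<open>Level \<open>l\<close> in the order with index \<open>i\<close>, counted from \<open>1\<close> and without the element \<open>0\<close> if \<open>l < d\<close>.\<close>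

definition nth_elem :: "nat \<Rightarrow> nat \<Rightarrow> nat \<Rightarrow> nat" where
  "nth_elem l i n = (if i = 1 then n else top_elem l + 1 - n)"

text \<open>Counts doublings: \<open>k d - 2\<close> per run through the last coordinate, with one
  run for each choice of nonzero coordinates at the levels from \<open>l\<close> to
  \<open>d - 1\<close>.\<close>

definition exponent :: "nat \<Rightarrow> nat" where
  "exponent l = (k d - 2) * (\<Prod>i = l..<d. k i - 1)"

lemma inner_upd_nth_elem:
  assumes "inner \<alpha>" "1 \<le> l" "l \<le> d" "1 \<le> n" "n \<le> top_elem l"
  shows "inner (\<alpha>(l := nth_elem l i n))"
  using assms k by (intro inner_upd) (auto simp: nth_elem_def top_elem_def split: if_splits)

lemma V_nth_elem_mono:
  assumes "inner \<alpha>" "1 \<le> l" "l < d" "1 \<le> n" "n < n'" "n' \<le> top_elem l"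
  shows "V (\<alpha>(l := nth_elem l (ord_idx k \<alpha> l) n)) < V (\<alpha>(l := nth_elem l (ord_idx k \<alpha> l) n'))"
proof (cases "ord_idx k \<alpha> l = 1")
  case True
  then show ?thesis
    using V_row_step[OF assms(1-3), of n n'] assms k(1)[of l] by (simp add: nth_elem_def top_elem_def)
next
  case False
  then show ?thesis
    using V_row_step[OF assms(1-3), of "top_elem l + 1 - n'" "top_elem l + 1 - n"] assms k(1)[of l]
    by (simp add: nth_elem_def top_elem_def)
qed

text \<open>When each term exceeds the sum of its predecessors, every new term at least doubles the
  prefix sum.\<close>

lemma V_last_growth:
  assumes \<alpha>: "inner \<alpha>"
  shows "2 ^ (k d - 2) * V (\<alpha>(d := nth_elem d (ord_idx k \<alpha> d) 1))
    \<le> V (\<alpha>(d := nth_elem d (ord_idx k \<alpha> d) (top_elem d)))"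
proof -
  let ?e = "nth_elem d (ord_idx k \<alpha> d)"
  define W where "W n = V (\<alpha>(d := ?e n))" for n
  have sum_less: "(\<Sum>m = 1..<n. W m) < W n" if n: "1 \<le> n" "n \<le> k d" for n
  proof -
    have set: "{m \<in> {1..k d}. prec (ord_idx k \<alpha> d) m (?e n)} = ?e ` {1..<n}"
    proof (cases "ord_idx k \<alpha> d = 1")
      case True
      then show ?thesis
        using n by (auto simp: nth_elem_def prec_def)
    next
      case False
      have "m \<in> (\<lambda>n. Suc (k d) - n) ` {1..<n}" if "m \<le> k d" "Suc (k d) - n < m" for m
        using that n by (intro image_eqI[of _ _ "Suc (k d) - m"]) auto
      then show ?thesis
        using n False by (auto simp: nth_elem_def prec_def top_elem_def)
    qed
    have inj: "inj_on ?e {1..<n}"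
      using n by (auto simp: inj_on_def nth_elem_def top_elem_def)
    have "1 \<le> ?e n" "?e n \<le> k d"
      using n by (auto simp: nth_elem_def top_elem_def)
    from V_last_step[OF \<alpha> this] show ?thesis
      unfolding set W_def sum.reindex[OF inj] by (simp add: o_def)
  qed
  have "2 ^ (n - 1) * W 1 \<le> (\<Sum>m = 1..<Suc n. W m)" if "1 \<le> n" "n \<le> k d" for n
    using that
  proof (induction n rule: dec_induct)
    case base
    then show ?case by simp
  next
    case (step n)
    have "2 ^ (Suc n - 1) * W 1 = 2 * (2 ^ (n - 1) * W 1)"
      using step.hyps by (simp add: power_eq_if)
    also have "\<dots> \<le> 2 * (\<Sum>m = 1..<Suc n. W m)"
      using step.IH step.prems by simp
    also have "\<dots> \<le> (\<Sum>m = 1..<Suc (Suc n). W m)"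
      using sum_less[of "Suc n"] step.prems by simp
    finally show ?case .
  qed
  \<comment> \<open>The prefix sum of \<open>k d - 1\<close> terms has doubled
    \<open>k d - 2\<close> times; the last term exceeds it without a further factor.\<close>
  from this[of "k d - 1"] k(2) have "2 ^ (k d - 2) * W 1 \<le> (\<Sum>m = 1..<k d. W m)"
    by (simp add: numeral_2_eq_2)
  with sum_less[of "k d"] k(2) have "2 ^ (k d - 2) * W 1 \<le> W (k d)"
    by simp
  then show ?thesis
    by (simp add: W_def top_elem_def)
qed

text \<open>Downward induction on \<open>l\<close>. Odd positions at level \<open>l\<close> run
  level \<open>Suc l\<close> forwards, even ones backwards. The number of positions is even, so the
  later coordinates are \<open>1\<close> at both ends of the traversal, as the hypothesis
  demands.\<close>

lemma V_growth:
  assumes "1 \<le> l" "l \<le> d" "inner \<alpha>" "\<And>i. l < i \<Longrightarrow> i \<le> d \<Longrightarrow> \<alpha> i = 1"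
  shows "2 ^ exponent l * V (\<alpha>(l := nth_elem l (ord_idx k \<alpha> l) 1))
    \<le> V (\<alpha>(l := nth_elem l (ord_idx k \<alpha> l) (top_elem l)))"
  using assms(2,1,3,4)
proof (induction arbitrary: \<alpha> rule: inc_induct)
  case base
  then show ?case
    using V_last_growth by (simp add: exponent_def del: fun_upd_apply)
next
  case (step l)
  let ?e = "nth_elem l (ord_idx k \<alpha> l)" and ?N = "exponent (Suc l)" and ?t = "top_elem (Suc l)"
  define W where "W n = V (\<alpha>(l := ?e n))" for n
  have l: "1 \<le> l" "l < d"
    using step.hyps step.prems by simp_all
  have t: "1 \<le> ?t"
    using k(1)[of "Suc l"] k(2) l by (cases "Suc l = d") (auto simp: top_elem_def)
  \<comment> \<open>Out and back: level \<open>Suc l\<close> runs from \<open>1\<close> to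
    \<open>?t\<close>, level \<open>l\<close> takes one step there, and level \<open>Suc l\<close>
    returns to \<open>1\<close>. Each run gains \<open>2 ^ ?N\<close>.\<close>
  have pair: "2 ^ (2 * ?N) * W n \<le> W (Suc n)" if n: "odd n" "Suc n \<le> top_elem l" for n
  proof -
    \<comment> \<open>As \<open>0\<close> has number \<open>0\<close> in both orders, the position
      counted from \<open>1\<close> without \<open>0\<close> is exactly \<open>num'\<close>, whose
      parity selects the order one level down.\<close>
    have ord: "ord_idx k (\<alpha>(l := ?e m)) (Suc l) = m mod 2" if "1 \<le> m" "m \<le> top_elem l" for m
    proof -
      have "ord_idx k (\<alpha>(l := ?e m)) l = ord_idx k \<alpha> l"
        by (rule ord_idx_cong) auto
      moreover have "num' (k l) (ord_idx k \<alpha> l) (?e m) = m"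
        using that l k(1)[of l] by (auto simp: num'_def nth_elem_def top_elem_def)
      moreover obtain l' where "l = Suc l'"
        using l by (cases l) auto
      ultimately show ?thesis
        by simp
    qed
    have same: "(\<alpha>(l := a))(Suc l := 1) = \<alpha>(l := a)" for a
      using step.prems(3)[of "Suc l"] l by auto
    have IH: "2 ^ ?N * V ((\<alpha>(l := ?e m))(Suc l := nth_elem (Suc l) (m mod 2) 1))
        \<le> V ((\<alpha>(l := ?e m))(Suc l := nth_elem (Suc l) (m mod 2) ?t))"
      if "1 \<le> m" "m \<le> top_elem l" for m
    proof -
      have "inner (\<alpha>(l := ?e m))"
        using step.prems l that by (intro inner_upd_nth_elem) auto
      moreover have "(\<alpha>(l := ?e m)) i = 1" if "Suc l < i" "i \<le> d" for i
        using step.prems(3)[of i] that by simp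
      ultimately show ?thesis
        using step.IH[of "\<alpha>(l := ?e m)"] unfolding ord[OF that] by (simp del: fun_upd_apply)
    qed
    have m: "1 \<le> n" "n \<le> top_elem l" "1 \<le> Suc n" "n mod 2 = 1" "Suc n mod 2 = 0"
      using n by (auto simp: odd_pos Suc_leI elim: oddE)
    have 1: "2 ^ ?N * W n \<le> V ((\<alpha>(l := ?e n))(Suc l := ?t))"
      using IH[OF m(1,2)] same[of "?e n"] unfolding m(4) by (simp add: nth_elem_def W_def)
    have 2: "2 ^ ?N * V ((\<alpha>(l := ?e (Suc n)))(Suc l := ?t)) \<le> W (Suc n)"
      using IH[OF m(3) n(2)] same[of "?e (Suc n)"] unfolding m(5) by (simp add: nth_elem_def W_def)
    have "inner (\<alpha>(Suc l := nth_elem (Suc l) 1 ?t))"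
      using step.prems l t by (intro inner_upd_nth_elem) auto
    then have inner: "inner (\<alpha>(Suc l := ?t))"
      by (simp add: nth_elem_def)
    have "ord_idx k (\<alpha>(Suc l := ?t)) l = ord_idx k \<alpha> l"
      by (rule ord_idx_cong) auto
    then have 3: "V ((\<alpha>(l := ?e n))(Suc l := ?t)) < V ((\<alpha>(l := ?e (Suc n)))(Suc l := ?t))"
      using V_nth_elem_mono[OF inner l m(1) _ n(2)] by (simp add: fun_upd_twist)
    have "2 ^ (2 * ?N) * W n = 2 ^ ?N * (2 ^ ?N * W n)"
      by (simp add: mult_2 power_add)
    also have "\<dots> \<le> 2 ^ ?N * V ((\<alpha>(l := ?e (Suc n)))(Suc l := ?t))"
      using 1 3 by (intro mult_left_mono) auto
    finally show ?thesis
      using 2 by simp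
  qed
  \<comment> \<open>Between two pairs, level \<open>l\<close> steps while coordinate
    \<open>Suc l\<close> rests at \<open>1\<close>; this gains no factor but loses none.\<close>
  have grow: "2 ^ (2 * s * ?N) * W 1 \<le> W (2 * s)" if "1 \<le> s" "2 * s \<le> top_elem l" for s
    using that
  proof (induction s rule: dec_induct)
    case base
    then show ?case
      using pair[of 1] by (simp add: numeral_2_eq_2)
  next
    case (step s)
    have "2 ^ (2 * Suc s * ?N) * W 1 = 2 ^ (2 * ?N) * (2 ^ (2 * s * ?N) * W 1)"
      by (simp add: power_add algebra_simps)
    also have "\<dots> \<le> 2 ^ (2 * ?N) * W (Suc (2 * s))"
      using step V_nth_elem_mono[OF \<open>inner \<alpha>\<close> l, of "2 * s" "Suc (2 * s)"]
      by (intro mult_left_mono) (auto simp: W_def)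
    also have "\<dots> \<le> W (Suc (Suc (2 * s)))"
      using step.prems by (intro pair) auto
    finally show ?case
      by simp
  qed
  have kl: "3 \<le> k l" "odd (k l)"
    using k(1)[of l] l by auto
  \<comment> \<open>Oddness of \<open>k l\<close> makes the number of nonzero elements even, so the
    pairs exhaust the level.\<close>
  then obtain s where s: "top_elem l = 2 * s" "1 \<le> s"
    using l by (auto simp: top_elem_def elim!: oddE)
  have "exponent l = 2 * s * ?N"
  proof -
    have "{l..<d} = insert l {Suc l..<d}"
      using l by auto
    then show ?thesis
      using s l by (simp add: exponent_def top_elem_def)
  qed
  then show ?case
    using grow[of s] s by (simp add: W_def del: fun_upd_apply)
qed

text \<open>The traversal starts at the index with all coordinates \<open>1\<close>, where a
  positive integer is at least \<open>1\<close>.\<close>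

lemma large_value: "\<exists>u. admissible d u \<and> 2 ^ exponent 1 \<le> T u"
proof -
  let ?\<alpha> = "\<lambda>i \<in> {1..d}. 1 :: nat"
  have "1 < k i" if "i \<in> {1..<d}" for i
    using k(1)[OF that] by simp
  then have inner: "inner ?\<alpha>"
    using k(2) unfolding inner_def indices_def by auto
  have "1 \<le> top_elem 1"
    using k(1)[of 1] k(2) d by (auto simp: top_elem_def)
  then have "0 < V (?\<alpha>(1 := nth_elem 1 1 1))"
    using inner d by (intro V_pos inner_upd_nth_elem) auto
  then have "2 ^ exponent 1 * 1 \<le> 2 ^ exponent 1 * V (?\<alpha>(1 := nth_elem 1 1 1))"
    by (intro mult_left_mono) auto
  also have "\<dots> \<le> V (?\<alpha>(1 := nth_elem 1 1 (top_elem 1)))"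
    using V_growth[OF order_refl d inner] by simp
  finally show ?thesis
    using admissible_unit_blocks by auto
qed

end

section \<open>From gates to signing forms, and the two bounds\<close>

lemma signing_form_gate:
  assumes "d \<ge> 1" "\<And>i. i \<in> {1..<d} \<Longrightarrow> k i \<ge> 3 \<and> odd (k i)" "k d \<ge> 3"
    and gate: "threshold_gate (input_vars d k) (hard_fun d k) p"
    and "multilinear d T" "\<And>x. antisymmetrise d (mpoly_eval p) x = T (diff_blocks d x)"
  shows "signing_form d k T"
proof
  fix u \<alpha>
  assume *: "admissible d u" "\<alpha> \<in> indices d k" "block_product d k u \<alpha> \<noteq> 0"
    "\<And>\<beta>. \<beta> \<in> indices d k \<Longrightarrow> block_product d k u \<beta> \<noteq> 0 \<Longrightarrow> \<beta> \<noteq> \<alpha> \<Longrightarrow> index_less d k \<beta> \<alpha>"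
  \<comment> \<open>Admissible block values come from an actual sign point, at which the gate can be
    evaluated.\<close>
  then have "is_leading d k (blocks_point d u) \<alpha>"
    by (simp add: is_leading_def signed_product_point)
  from sgn_antisymmetrise_gate[OF assms(1) gate blocks_point_mem[OF *(1)] this]
  show "sgn (T u) = sgn (block_product d k u \<alpha>)"
    by (simp add: signed_product_point *(1) assms(6) diff_blocks_point)
qed (use assms in auto)

theorem theorem4p2:
  fixes d n :: nat and k :: "nat \<Rightarrow> nat"
  assumes "d \<ge> 1"
    and "\<And>i. i \<in> {1..<d} \<Longrightarrow> k i \<ge> 3 \<and> odd (k i)"
    and "k d \<ge> 3"
    and "n = (\<Sum>i = 1..<d. k i) + 2 * k d"
  shows "threshold_degree (input_vars d k) (hard_fun d k) = d \<and>
    real (threshold_weight (input_vars d k) (hard_fun d k) d)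
      \<ge> 2 powr ((real (k d) - 2) * (\<Prod>i = 1..<d. real (k i) - 1) - real d * log 2 (real n))"
proof -
  let ?V = "input_vars d k" and ?f = "hard_fun d k"
  let ?E = "(k d - 2) * (\<Prod>i = 1..<d. k i - 1)"
  \<comment> \<open>Serves both claims: below degree \<open>d\<close> the antisymmetrisation
    vanishes, a contradiction, and in degree \<open>d\<close> the value bounds the weight.\<close>
  have large: "\<exists>x. (\<forall>v. x v \<in> {- 1, 1}) \<and> 2 ^ ?E \<le> antisymmetrise d (mpoly_eval p) x"
    if gate: "threshold_gate ?V ?f p" and deg: "mpoly_degree p \<le> d" for p
  proof -
    obtain T where form: "multilinear d T" "\<And>x. antisymmetrise d (mpoly_eval p) x = T (diff_blocks d x)"
      using antisymmetrise_multilinear[OF assms(1) deg] by blast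
    interpret signing_form d k T
      using signing_form_gate[OF assms(1-3) gate form] .
    obtain u where u: "admissible d u" "2 ^ exponent 1 \<le> T u"
      using large_value by blast
    then have "2 ^ ?E \<le> antisymmetrise d (mpoly_eval p) (blocks_point d u)"
      by (simp add: form(2) diff_blocks_point exponent_def)
    then show ?thesis
      using blocks_point_mem[OF u(1)] by blast
  qed
  obtain p0 where p0: "threshold_gate ?V ?f p0" "mpoly_degree p0 \<le> d"
    using threshold_gate_exists[OF assms(1)] by blast
  have lower: "d \<le> mpoly_degree p" if gate: "threshold_gate ?V ?f p" for p
  proof (rule ccontr)
    assume *: "\<not> d \<le> mpoly_degree p"
    then obtain x where "2 ^ ?E \<le> antisymmetrise d (mpoly_eval p) x"
      using large[OF gate] by auto
    then have "(2 :: int) ^ ?E \<le> 0"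
      using antisymmetrise_low_degree[of p d x] * by simp
    then show False
      by (simp add: not_le)
  qed
  have "threshold_degree ?V ?f = d"
    unfolding threshold_degree_def
    by (rule Least_equality) (use p0 lower in \<open>auto intro: antisym\<close>)
  moreover have "2 powr ((real (k d) - 2) * (\<Prod>i = 1..<d. real (k i) - 1) - real d * log 2 (real n))
      \<le> real (threshold_weight ?V ?f d)"
  proof -
    have "\<exists>p. threshold_gate ?V ?f p \<and> mpoly_degree p \<le> d \<and> mpoly_weight p = threshold_weight ?V ?f d"
      unfolding threshold_weight_def
      by (rule LeastI_ex) (use p0 in blast)
    then obtain p where p: "threshold_gate ?V ?f p" "mpoly_degree p \<le> d"
      "mpoly_weight p = threshold_weight ?V ?f d"
      by blast
    obtain x where x: "\<And>v. x v \<in> {- 1, 1}" "2 ^ ?E \<le> antisymmetrise d (mpoly_eval p) x"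
      using large[OF p(1,2)] by blast
    have "(2 :: int) ^ ?E \<le> 2 ^ d * int (mpoly_weight p)"
      using abs_antisymmetrise_le_weight[of d x p, OF assms(1) x(1)] x(2) by linarith
    then have "real_of_int (2 ^ ?E) \<le> real_of_int (2 ^ d * int (mpoly_weight p))"
      by (simp only: of_int_le_iff)
    then have main: "(2 :: real) ^ ?E \<le> 2 ^ d * real (mpoly_weight p)"
      by simp
    have "(\<Prod>i = 1..<d. real (k i) - 1) = (\<Prod>i = 1..<d. real (k i - 1))"
    proof (rule prod.cong[OF refl])
      fix i assume "i \<in> {1..<d}"
      then show "real (k i) - 1 = real (k i - 1)"
        using assms(2)[of i] by simp
    qed
    then have E: "(real (k d) - 2) * (\<Prod>i = 1..<d. real (k i) - 1) = real ?E"
      using assms(3) by simp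
    have "2 \<le> n"
      using assms(3,4) by linarith
    then have n: "2 \<le> real n"
      by simp
    have "2 powr (real ?E - real d * log 2 (real n)) = 2 ^ ?E / 2 powr (log 2 (real n) * real d)"
      by (simp only: powr_diff powr_realpow mult.commute zero_less_numeral)
    also have "2 powr (log 2 (real n) * real d) = real n ^ d"
      using n by (simp add: powr_powr[symmetric] powr_realpow)
    \<comment> \<open>The argument loses only the factor \<open>2 ^ d\<close>, which is at most
      \<open>n ^ d\<close>.\<close>
    also have "2 ^ ?E / real n ^ d \<le> 2 ^ ?E / 2 ^ d"
      using n by (intro divide_left_mono power_mono mult_pos_pos) auto
    also have "\<dots> \<le> real (mpoly_weight p)"
      using main by (simp add: field_simps)
    finally show ?thesis
      unfolding E p(3) .
  qed
  ultimately show ?thesis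
    by blast
qed

end
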